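(* Let $((X^n(t))_{t\in[0,T]})_{n\in\mathbb{N}}$ be a family of $p$-dimensional, continuous, centered Gaussian processes, starting from zero, with independent components, which satisfies an LDP on $C([0,T],\mathbb{R}^p)$ with speed $\gamma_n$ and good rate function $$I(h)=\sum_{i=1}^p I_i(h_i),\qquad I_i(h_i)=\begin{cases}\frac12\|h_i\|^2_{\mathscr{H}_i} & h_i\in\mathscr{H}_i\\ +\infty & h_i\notin\mathscr{H}_i,\end{cases}$$ where $\mathscr{H}_i\subset C([0,T],\mathbb{R})$ is the reproducing kernel Hilbert space associated to some covariance function $k_{ii}$. Let $((A^n,B^n))_{n\in\mathbb{N}}$ be a $[0,+\infty)^p\times C([0,T],\mathbb{R}^p)$-valued random sequence (so $A^n$ is a $[0,+\infty)^p$-valued random variable and $B^n$ is a continuous $\mathbb{R}^p$-valued process), independent of $(X^n)_{n\in\mathbb{N}}$, which satisfies an LDP with speed $\gamma_n$ and good rate function $I_{(A,B)}$. Set $$Z^n=A^n\circ X^n+B^n\quad(n\in\mathbb{N}),$$ i.e. $Z^n(t)=A^n\circ X^n(t)+B^n(t)$ for $t\in[0,T]$, where $u\circ v=(u_1v_1,\ldots,u_pv_p)$ is the Hadamard product. Then $((A^n,B^n),Z^n)_{n\in\mathbb{N}}$ satisfies an LDP with speed $\gamma_n$ and rate function $$I_{(A,B),Z}((a,b),z)=I_{(A,B)}(a,b)+\sum_{i=1}^pJ_i(z_i|(a_i,b_i)),$$ where $$J_i(z_i|(a_i,b_i))=\begin{cases}\frac{1}{2a_i^2}\|z_i-b_i\|^2_{\mathscr{H}_i}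 & a_i>0\\ 0 & z_i-b_i=0\text{ and }a_i=0\\ +\infty&\text{otherwise.}\end{cases}$$ Moreover $(Z^n)_{n\in\mathbb{N}}$ satisfies an LDP with speed $\gamma_n$ and the good rate function $$I_Z(z)=\inf_{(a,b)\in[0,+\infty)^p\times C([0,T],\mathbb{R}^p)}\Big\{I_{(A,B)}(a,b)+\sum_{i=1}^pJ_i(z_i|(a_i,b_i))\Big\}.$$
   Context: $T>0$ and $p\ge1$ are fixed. $C([0,T],\mathbb{R}^p)$ carries the sup-norm $\|f\|_\infty=\sup_{0\le t\le T}\|f(t)\|$ ($\|\cdot\|$ Euclidean); product spaces carry the product topology. Large deviation principle (LDP): let $E$ be a topological space with Borel $\sigma$-algebra and $\gamma_n>0$ with $\gamma_n\to+\infty$ (the speed). A rate function is a lower semicontinuous $I:E\to[0,+\infty]$; it is good if $\{I\le a\}$ is compact for all $a\ge0$. Probability measures $(\mu_n)$ satisfy the LDP on $E$ with rate function $I$ and speed $\gamma_n$ if $\liminf_n\frac1{\gamma_n}\log\mu_n(\Theta)\ge-\inf_{x\in\Theta}I(x)$ for every open $\Theta$ and $\limsup_n\frac1{\gamma_n}\log\mu_n(\Gamma)\le-\inf_{x\in\Gamma}I(x)$ for every closed $\Gamma$. Random elements satisfy an LDP if their laws do. Reproducing kernel Hilbert space (RKHS): let $U=(U(t))_{t\in[0,T]}$ be a real continuous centered Gaussian process with covariance function $k$. Let $H$ be the $L^2$-closure of $\{\int_0^TU(t)\,d\lambda(t):\lambda\text{ a signed measure on }[0,T]\}$. The RKHS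 of $k$ is $\mathscr{H}=\{h: h(t)=\mathbb{E}[U(t)Y],\ Y\in H\}\subset C([0,T],\mathbb{R})$, with inner product transported from $L^2$ by the bijection $Y\mapsto\mathbb{E}[U(\cdot)Y]$. Equivalently it is the completion of the functions $x(t)=\int_0^Tk(t,s)\,d\lambda(s)$ under $\|x\|^2=\int_0^T\int_0^Tk(t,s)\,d\lambda(t)\,d\lambda(s)$. Convention: $\|h\|^2_{\mathscr{H}_i}=+\infty$ if $h\notin\mathscr{H}_i$. *)

theory Defs
  imports "HOL-Probability.Probability"
begin

section \<open>Path spaces and Borel sets of an abstract topology\<close>

definition borel_of :: "'a topology \<Rightarrow> 'a measure" where
  "borel_of E = sigma (topspace E) {\<Theta>. openin E \<Theta>}"

text \<open>\<open>C([0,T], 'a)\<close> with the sup-norm topology. As usual for \<^const>\<open>cfunspace\<close>, its elements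
  are extensional: they equal \<^const>\<open>undefined\<close> outside \<open>[0,T]\<close>.\<close>

definition path_space :: "real \<Rightarrow> (real \<Rightarrow> 'a::metric_space) topology" where
  "path_space T = mtopology_of (cfunspace (top_of_set {0..T}) euclidean_metric)"

definition nonneg_orthant :: "(real ^ 'p) topology" where
  "nonneg_orthant = top_of_set {a. \<forall>i. 0 \<le> a $ i}"

definition coord :: "real \<Rightarrow> 'p \<Rightarrow> (real \<Rightarrow> real ^ 'p) \<Rightarrow> real \<Rightarrow> real" where
  "coord T i h = (\<lambda>t\<in>{0..T}. h t $ i)"

text \<open>Multiplication on \<^typ>\<open>real ^ 'p\<close> is already componentwise.\<close>

abbreviation hadamard :: "real ^ 'p \<Rightarrow> real ^ 'p \<Rightarrow> real ^ 'p" (infixl \<open>\<odot>\<close> 70) where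
  "u \<odot> v \<equiv> u * v"


section \<open>Large deviation principles\<close>

text \<open>Rate functions have values in \<open>[0,+\<infinity>]\<close>, i.e. in \<^typ>\<open>ennreal\<close>; their values outside
  \<^term>\<open>topspace E\<close> are irrelevant.\<close>

definition rate_function :: "'a topology \<Rightarrow> ('a \<Rightarrow> ennreal) \<Rightarrow> bool" where
  "rate_function E I \<longleftrightarrow> (\<forall>a. openin E {x \<in> topspace E. a < I x})"

definition good_rate_function :: "'a topology \<Rightarrow> ('a \<Rightarrow> ennreal) \<Rightarrow> bool" where
  "good_rate_function E I \<longleftrightarrow>
     rate_function E I \<and> (\<forall>a::real. 0 \<le> a \<longrightarrow> compactin E {x \<in> topspace E. I x \<le> ennreal a})"

text \<open>The library's \<^const>\<open>ln\<close> is total with an irrelevant value at \<open>0\<close>; here \<open>log 0 = -\<infinity>\<close>.\<close>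

definition log_prob :: "real \<Rightarrow> ereal" where
  "log_prob x = (if x = 0 then -\<infinity> else ereal (ln x))"

definition LDP :: "'a topology \<Rightarrow> (nat \<Rightarrow> 'a measure) \<Rightarrow> (nat \<Rightarrow> real) \<Rightarrow> ('a \<Rightarrow> ennreal) \<Rightarrow> bool" where
  "LDP E \<mu> \<gamma> I \<longleftrightarrow>
     (\<forall>n. prob_space (\<mu> n) \<and> sets (\<mu> n) = sets (borel_of E)) \<and>
     (\<forall>n. 0 < \<gamma> n) \<and> filterlim \<gamma> at_top sequentially \<and>
     rate_function E I \<and>
     (\<forall>\<Theta>. openin E \<Theta> \<longrightarrow>
        - enn2ereal (INF x\<in>\<Theta>. I x)
          \<le> liminf (\<lambda>n. ereal (1 / \<gamma> n) * log_prob (measure (\<mu> n) \<Theta>))) \<and>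
     (\<forall>\<Gamma>. closedin E \<Gamma> \<longrightarrow>
        limsup (\<lambda>n. ereal (1 / \<gamma> n) * log_prob (measure (\<mu> n) \<Gamma>))
          \<le> - enn2ereal (INF x\<in>\<Gamma>. I x))"

definition random_LDP ::
  "'w measure \<Rightarrow> 'a topology \<Rightarrow> (nat \<Rightarrow> 'w \<Rightarrow> 'a) \<Rightarrow> (nat \<Rightarrow> real) \<Rightarrow> ('a \<Rightarrow> ennreal) \<Rightarrow> bool" where
  "random_LDP M E X \<gamma> I \<longleftrightarrow>
     (\<forall>n. X n \<in> measurable M (borel_of E)) \<and> LDP E (\<lambda>n. distr M (borel_of E) (X n)) \<gamma> I"


text \<open>The library's \<^const>\<open>prob_space.indep_var\<close> needs both variables to have the same type.\<close>

definition independent_rv ::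
  "'w measure \<Rightarrow> 'a measure \<Rightarrow> ('w \<Rightarrow> 'a) \<Rightarrow> 'b measure \<Rightarrow> ('w \<Rightarrow> 'b) \<Rightarrow> bool" where
  "independent_rv M E V F W \<longleftrightarrow>
     V \<in> measurable M E \<and> W \<in> measurable M F \<and>
     prob_space.indep_set M {V -` S \<inter> space M | S. S \<in> sets E} {W -` S \<inter> space M | S. S \<in> sets F}"


section \<open>Gaussian processes\<close>

text \<open>The Dirac mass at \<open>0\<close> counts as a (degenerate) Gaussian law.\<close>

definition centered_gaussian :: "'w measure \<Rightarrow> ('w \<Rightarrow> real) \<Rightarrow> bool" where
  "centered_gaussian M Y \<longleftrightarrow> Y \<in> borel_measurable M \<and>
     ((AE \<omega> in M. Y \<omega> = 0) \<or>
      (\<exists>\<sigma>>0. distributed M lborel Y (\<lambda>x. ennreal (normal_density 0 \<sigma> x))))"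

definition continuous_centered_gaussian_process ::
  "'w measure \<Rightarrow> real \<Rightarrow> ('w \<Rightarrow> real \<Rightarrow> 'a::euclidean_space) \<Rightarrow> bool" where
  "continuous_centered_gaussian_process M T X \<longleftrightarrow>
     prob_space M \<and> X \<in> measurable M (borel_of (path_space T)) \<and>
     (\<forall>S c. finite S \<and> S \<subseteq> {0..T} \<longrightarrow> centered_gaussian M (\<lambda>\<omega>. \<Sum>t\<in>S. c t \<bullet> X \<omega> t))"

definition has_covariance ::
  "'w measure \<Rightarrow> real \<Rightarrow> ('w \<Rightarrow> real \<Rightarrow> real) \<Rightarrow> (real \<Rightarrow> real \<Rightarrow> real) \<Rightarrow> bool" where
  "has_covariance M T U k \<longleftrightarrow>
     (\<forall>s\<in>{0..T}. \<forall>t\<in>{0..T}. k s t = (\<integral>\<omega>. U \<omega> s * U \<omega> t \<partial>M))"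


section \<open>Reproducing kernel Hilbert space of a Gaussian process\<close>

text \<open>Everything below is written in terms of a process \<open>U\<close> on a probability space \<open>M\<close>; it depends
  on \<open>(M, U)\<close> only through the covariance function of \<open>U\<close>. A signed measure \<open>\<lambda>\<close> on \<open>[0,T]\<close> is
  represented by a pair of finite measures with \<open>\<lambda> = \<alpha> - \<beta>\<close> (Jordan decomposition).\<close>

definition finite_borel_on :: "real \<Rightarrow> real measure \<Rightarrow> bool" where
  "finite_borel_on T \<alpha> \<longleftrightarrow> finite_measure \<alpha> \<and> sets \<alpha> = sets (restrict_space borel {0..T})"

definition signed_integrals :: "real \<Rightarrow> ('w \<Rightarrow> real \<Rightarrow> real) \<Rightarrow> ('w \<Rightarrow> real) set" where
  "signed_integrals T U =
     {(\<lambda>\<omega>. (\<integral>t. U \<omega> t \<partial>\<alpha>) - (\<integral>t. U \<omega> t \<partial>\<beta>)) | \<alpha> \<beta>. finite_borel_on T \<alpha> \<and> finite_borel_on T \<beta>}"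

text \<open>Elements of \<open>L\<^sup>2(M)\<close> are functions, not classes modulo almost sure equality.\<close>

definition L2_closure :: "'w measure \<Rightarrow> ('w \<Rightarrow> real) set \<Rightarrow> ('w \<Rightarrow> real) set" where
  "L2_closure M S = {Y \<in> borel_measurable M. integrable M (\<lambda>\<omega>. (Y \<omega>)\<^sup>2) \<and>
     (\<forall>e::real. 0 < e \<longrightarrow> (\<exists>V\<in>S. (\<integral>\<^sup>+\<omega>. ennreal ((Y \<omega> - V \<omega>)\<^sup>2) \<partial>M) < ennreal e))}"

definition gaussian_space :: "'w measure \<Rightarrow> real \<Rightarrow> ('w \<Rightarrow> real \<Rightarrow> real) \<Rightarrow> ('w \<Rightarrow> real) set" where
  "gaussian_space M T U = L2_closure M (signed_integrals T U)"

definition rkhs_map :: "'w measure \<Rightarrow> real \<Rightarrow> ('w \<Rightarrow> real \<Rightarrow> real) \<Rightarrow> ('w \<Rightarrow> real) \<Rightarrow> real \<Rightarrow> real" where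
  "rkhs_map M T U Y = (\<lambda>t\<in>{0..T}. \<integral>\<omega>. U \<omega> t * Y \<omega> \<partial>M)"

definition rkhs :: "'w measure \<Rightarrow> real \<Rightarrow> ('w \<Rightarrow> real \<Rightarrow> real) \<Rightarrow> (real \<Rightarrow> real) set" where
  "rkhs M T U = rkhs_map M T U ` gaussian_space M T U"

text \<open>On \<^term>\<open>gaussian_space M T U\<close> the map \<^term>\<open>rkhs_map M T U\<close> is injective up to almost sure
  equality, so the choice of preimage made by \<^const>\<open>inv_into\<close> does not matter.\<close>

definition rkhs_inner ::
  "'w measure \<Rightarrow> real \<Rightarrow> ('w \<Rightarrow> real \<Rightarrow> real) \<Rightarrow> (real \<Rightarrow> real) \<Rightarrow> (real \<Rightarrow> real) \<Rightarrow> real" where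
  "rkhs_inner M T U g h =
     (let Y = inv_into (gaussian_space M T U) (rkhs_map M T U)
      in \<integral>\<omega>. Y g \<omega> * Y h \<omega> \<partial>M)"

definition rkhs_norm2 ::
  "'w measure \<Rightarrow> real \<Rightarrow> ('w \<Rightarrow> real \<Rightarrow> real) \<Rightarrow> (real \<Rightarrow> real) \<Rightarrow> ennreal" where
  "rkhs_norm2 M T U h = (if h \<in> rkhs M T U then ennreal (rkhs_inner M T U h h) else \<infinity>)"


section \<open>The rate functions of the theorem\<close>

definition gaussian_rate ::
  "'w measure \<Rightarrow> real \<Rightarrow> ('w \<Rightarrow> real \<Rightarrow> real) \<Rightarrow> (real \<Rightarrow> real) \<Rightarrow> ennreal" where
  "gaussian_rate M T U h =
     (if h \<in> rkhs M T U then ennreal (1 / 2) * rkhs_norm2 M T U h else \<infinity>)"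

definition cond_rate ::
  "'w measure \<Rightarrow> real \<Rightarrow> ('w \<Rightarrow> real \<Rightarrow> real) \<Rightarrow> (real \<Rightarrow> real) \<Rightarrow> real \<Rightarrow> (real \<Rightarrow> real) \<Rightarrow> ennreal" where
  "cond_rate M T U z a b =
     (if 0 < a then ennreal (1 / (2 * a\<^sup>2)) * rkhs_norm2 M T U (\<lambda>t\<in>{0..T}. z t - b t)
      else if a = 0 \<and> (\<forall>t\<in>{0..T}. z t - b t = 0) then 0
      else \<infinity>)"

end

theory Submission
  imports Defs
begin

text \<open>Let \<open>Y\<^sub>n = (A\<^sub>n, B\<^sub>n)\<close>. Since \<open>Z\<^sub>n\<close> is the image of \<open>(Y\<^sub>n, X\<^sub>n)\<close> under the continuous map
\<open>((a, b), x) \<mapsto> a \<odot> x + b\<close>, both large deviation principles are instances of the contraction principle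
(\<open>rate_contraction\<close>), applied first to \<open>((a, b), x) \<mapsto> ((a, b), a \<odot> x + b)\<close> and then to the second
projection. What has to be supplied is the principle for the pair \<open>(Y\<^sub>n, X\<^sub>n)\<close> and the value of the
contracted rate function.

The pair satisfies the principle with rate function \<open>I\<^sub>A\<^sub>B + I\<^sub>X\<close>, by independence
(\<open>product_LDP\<close>). The lower bound is immediate on open rectangles. For the upper bound, the goodness of
both rate functions replaces exponential tightness: the product \<open>K \<times> L\<close> of two sublevel sets is compact,
so its part in a closed set \<open>\<Gamma>\<close> is covered by finitely many rectangles on whose closures the two rate
functions stay above numbers with a sum just below \<open>inf\<^sub>\<Gamma> (I\<^sub>A\<^sub>B + I\<^sub>X)\<close>. By the tube lemma the rest of
\<open>\<Gamma>\<close> is covered by \<open>{x \<notin> G}\<close> and \<open>{y \<notin> H}\<close> with \<open>G \<supseteq> K\<close> and \<open>H \<supseteq> L\<close> open,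
and each marginal bound applies to one of these. Joint measurability needs the separability of the
path space (\<open>second_countable_path_space\<close>).

The contracted rate function is \<open>I\<^sub>A\<^sub>B(a, b)\<close> plus the infimum of \<open>I\<^sub>X(x)\<close> over the \<open>x\<close> with
\<open>z = a \<odot> x + b\<close>. The infimum splits over the coordinates. Where \<open>a\<^sub>i > 0\<close>, the only candidate is
\<open>x\<^sub>i = (z\<^sub>i - b\<^sub>i) / a\<^sub>i\<close>, and the squared norm is homogeneous of degree two; where \<open>a\<^sub>i = 0\<close>, the equation
forces \<open>z\<^sub>i = b\<^sub>i\<close> and \<open>x\<^sub>i = 0\<close> is optimal. So the infimum is \<open>\<Sum>\<^sub>i J\<^sub>i\<close>, and it is
attained when it is finite (\<open>total_cond_rate_le\<close>, \<open>total_cond_rate_attained\<close>).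

Homogeneity requires that the squared norm does not depend on the element of the Gaussian
space that represents a function of the reproducing kernel Hilbert space, i.e. that \<open>E[U\<^sub>t D] = 0\<close> for
all \<open>t\<close> makes a difference \<open>D\<close> of two such elements vanish almost surely (\<open>rkhs_map_inj_AE\<close>): by
Fubini, \<open>D\<close> is then orthogonal to all integrals of \<open>U\<close> against signed measures, in whose closed span it
lies. Fubini applies because \<open>E[U\<^sub>t\<^sup>2]\<close> is bounded in \<open>t\<close> (\<open>second_moment_bounded\<close>).\<close>

section \<open>Large deviation bounds as eventual exponential bounds\<close>

lemma limsup_le_uminus_iff:
  fixes f :: "nat \<Rightarrow> ereal" and b :: ereal
  shows "limsup f \<le> - b \<longleftrightarrow> (\<forall>\<beta>::real. ereal \<beta> < b \<longrightarrow> (\<forall>\<^sub>F n in sequentially. f n \<le> ereal (- \<beta>)))"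
proof
  assume L: "limsup f \<le> - b"
  show "\<forall>\<beta>::real. ereal \<beta> < b \<longrightarrow> (\<forall>\<^sub>F n in sequentially. f n \<le> ereal (- \<beta>))"
  proof (intro allI impI)
    fix \<beta> :: real assume "ereal \<beta> < b"
    then have "- b < ereal (- \<beta>)" by (metis ereal_minus_less_minus uminus_ereal.simps(1))
    then have "\<forall>\<^sub>F n in sequentially. f n < ereal (- \<beta>)"
      using L unfolding Limsup_le_iff by blast
    then show "\<forall>\<^sub>F n in sequentially. f n \<le> ereal (- \<beta>)" by (rule eventually_mono) simp
  qed
next
  assume R: "\<forall>\<beta>::real. ereal \<beta> < b \<longrightarrow> (\<forall>\<^sub>F n in sequentially. f n \<le> ereal (- \<beta>))"
  show "limsup f \<le> - b" unfolding Limsup_le_iff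
  proof (intro allI impI)
    fix y assume "- b < y"
    then obtain r :: real where r: "- b < ereal r" "ereal r < y" using ereal_dense2 by blast
    then have "ereal (- r) < b" by (metis ereal_minus_less_minus uminus_ereal.simps(1) ereal_uminus_uminus)
    with R have "\<forall>\<^sub>F n in sequentially. f n \<le> ereal r" by fastforce
    then show "\<forall>\<^sub>F n in sequentially. f n < y"
      by (rule eventually_mono) (use r in order)
  qed
qed

lemma uminus_le_liminf_iff:
  fixes f :: "nat \<Rightarrow> ereal" and b :: ereal
  shows "- b \<le> liminf f \<longleftrightarrow> (\<forall>\<beta>::real. b < ereal \<beta> \<longrightarrow> (\<forall>\<^sub>F n in sequentially. ereal (- \<beta>) \<le> f n))"
proof
  assume L: "- b \<le> liminf f"
  show "\<forall>\<beta>::real. b < ereal \<beta> \<longrightarrow> (\<forall>\<^sub>F n in sequentially. ereal (- \<beta>) \<le> f n)"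
  proof (intro allI impI)
    fix \<beta> :: real assume "b < ereal \<beta>"
    then have "ereal (- \<beta>) < - b" by (metis ereal_minus_less_minus uminus_ereal.simps(1))
    then have "\<forall>\<^sub>F n in sequentially. ereal (- \<beta>) < f n"
      using L unfolding le_Liminf_iff by blast
    then show "\<forall>\<^sub>F n in sequentially. ereal (- \<beta>) \<le> f n" by (rule eventually_mono) simp
  qed
next
  assume R: "\<forall>\<beta>::real. b < ereal \<beta> \<longrightarrow> (\<forall>\<^sub>F n in sequentially. ereal (- \<beta>) \<le> f n)"
  show "- b \<le> liminf f" unfolding le_Liminf_iff
  proof (intro allI impI)
    fix y assume "y < - b"
    then obtain r :: real where r: "y < ereal r" "ereal r < - b" using ereal_dense2 by blast
    then have "b < ereal (- r)" by (metis ereal_minus_less_minus uminus_ereal.simps(1) ereal_uminus_uminus)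
    with R have "\<forall>\<^sub>F n in sequentially. ereal r \<le> f n" by fastforce
    then show "\<forall>\<^sub>F n in sequentially. y < f n"
      by (rule eventually_mono) (use r in order)
  qed
qed

lemma log_prob_le_iff:
  assumes "0 < g" "0 \<le> p"
  shows "ereal (1 / g) * log_prob p \<le> ereal (- \<beta>) \<longleftrightarrow> p \<le> exp (- (g * \<beta>))"
proof (cases "p = 0")
  case True
  with assms show ?thesis by (simp add: log_prob_def)
next
  case False
  with assms have "0 < p" by simp
  have "ln p / g \<le> - \<beta> \<longleftrightarrow> ln p \<le> - (g * \<beta>)" using assms by (simp add: field_simps)
  also have "\<dots> \<longleftrightarrow> p \<le> exp (- (g * \<beta>))" using \<open>0 < p\<close> by (metis exp_le_cancel_iff exp_ln)
  finally show ?thesis using False by (simp add: log_prob_def)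
qed

lemma log_prob_ge_iff:
  assumes "0 < g" "0 \<le> p"
  shows "ereal (- \<beta>) \<le> ereal (1 / g) * log_prob p \<longleftrightarrow> exp (- (g * \<beta>)) \<le> p"
proof (cases "p = 0")
  case True
  with assms show ?thesis by (simp add: log_prob_def not_le)
next
  case False
  with assms have "0 < p" by simp
  have "- \<beta> \<le> ln p / g \<longleftrightarrow> - (g * \<beta>) \<le> ln p" using assms by (simp add: field_simps)
  also have "\<dots> \<longleftrightarrow> exp (- (g * \<beta>)) \<le> p" using \<open>0 < p\<close> by (metis exp_le_cancel_iff exp_ln)
  finally show ?thesis using False by (simp add: log_prob_def)
qed

lemma space_borel_of [simp]: "space (borel_of E) = topspace E"
  unfolding borel_of_def by (rule space_measure_of) (auto dest: openin_subset)

lemma sets_borel_of: "sets (borel_of E) = sigma_sets (topspace E) {\<Theta>. openin E \<Theta>}"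
  unfolding borel_of_def by (rule sets_measure_of) (auto dest: openin_subset)

lemma openin_borel_of: "openin E S \<Longrightarrow> S \<in> sets (borel_of E)"
  unfolding sets_borel_of by auto

lemma closedin_borel_of: 
  assumes "closedin E S" shows "S \<in> sets (borel_of E)"
proof -
  have "topspace E - (topspace E - S) \<in> sets (borel_of E)"
    using assms openin_borel_of[of E] sets.compl_sets[of "topspace E - S" "borel_of E"]
    by (simp add: closedin_def)
  then show ?thesis using assms by (simp add: closedin_def double_diff)
qed

lemma enn2ereal_INF_less_iff:
  "enn2ereal (INF x\<in>S. I x) < c \<longleftrightarrow> (\<exists>x\<in>S. enn2ereal (I x) < c)"
proof (cases "c \<le> 0")
  case True
  then show ?thesis using enn2ereal_nonneg by (meson leD order_trans)
next
  case False
  then obtain d where d: "c = enn2ereal d" by (metis enn2ereal_e2ennreal nle_le)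
  show ?thesis unfolding d less_ennreal.rep_eq[symmetric] by (rule Inf_less_iff[of "I ` S", simplified])
qed

lemma le_enn2ereal_INF_iff:
  "c \<le> enn2ereal (INF x\<in>S. I x) \<longleftrightarrow> (\<forall>x\<in>S. c \<le> enn2ereal (I x))"
proof (cases "c \<le> 0")
  case True
  then show ?thesis using enn2ereal_nonneg by (meson order_trans)
next
  case False
  then obtain d where d: "c = enn2ereal d" by (metis enn2ereal_e2ennreal nle_le)
  show ?thesis unfolding d less_eq_ennreal.rep_eq[symmetric] by (rule le_INF_iff)
qed

text \<open>The form of the principle in which everything below is done: logarithms, limits inferior and
superior and infima are all replaced by eventual bounds \<open>exp (- (\<gamma> n * \<beta>))\<close> with real \<open>\<beta>\<close>, so that no
limits of extended real numbers remain. The second number \<open>\<beta>'\<close> in the upper bound expresses that \<open>\<beta>\<close>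
lies strictly below the infimum of the rate function.\<close>

lemma random_LDP_iff:
  assumes "prob_space M"
  shows "random_LDP M E X \<gamma> I \<longleftrightarrow>
    (\<forall>n. X n \<in> measurable M (borel_of E)) \<and> (\<forall>n. 0 < \<gamma> n) \<and> filterlim \<gamma> at_top sequentially \<and>
    rate_function E I \<and>
    (\<forall>\<Theta> x \<beta>. openin E \<Theta> \<longrightarrow> x \<in> \<Theta> \<longrightarrow> enn2ereal (I x) < ereal \<beta> \<longrightarrow>
      (\<forall>\<^sub>F n in sequentially. exp (- (\<gamma> n * \<beta>)) \<le> measure M {\<omega> \<in> space M. X n \<omega> \<in> \<Theta>})) \<and>
    (\<forall>\<Gamma> \<beta> \<beta>'. closedin E \<Gamma> \<longrightarrow> \<beta> < \<beta>' \<longrightarrow> (\<forall>x\<in>\<Gamma>. ereal \<beta>' \<le> enn2ereal (I x)) \<longrightarrow>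
      (\<forall>\<^sub>F n in sequentially. measure M {\<omega> \<in> space M. X n \<omega> \<in> \<Gamma>} \<le> exp (- (\<gamma> n * \<beta>))))"
    (is "?L \<longleftrightarrow> ?meas \<and> ?pos \<and> ?lim \<and> ?rate \<and> ?low \<and> ?up")
proof (cases "?meas \<and> ?pos")
  case False
  then show ?thesis unfolding random_LDP_def LDP_def by blast
next
  case True
  interpret prob_space M by fact
  have m: "measure (distr M (borel_of E) (X n)) S = measure M {\<omega> \<in> space M. X n \<omega> \<in> S}"
    if "S \<in> sets (borel_of E)" for S n
    using True that by (subst measure_distr) (auto intro!: arg_cong[where f="measure M"])
  have ps: "prob_space (distr M (borel_of E) (X n))" for n
    using True by (intro prob_space_distr) auto
  have lo: "- enn2ereal (INF x\<in>\<Theta>. I x)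
          \<le> liminf (\<lambda>n. ereal (1 / \<gamma> n) * log_prob (measure (distr M (borel_of E) (X n)) \<Theta>)) \<longleftrightarrow>
     (\<forall>x \<beta>. x \<in> \<Theta> \<longrightarrow> enn2ereal (I x) < ereal \<beta> \<longrightarrow>
      (\<forall>\<^sub>F n in sequentially. exp (- (\<gamma> n * \<beta>)) \<le> measure M {\<omega> \<in> space M. X n \<omega> \<in> \<Theta>}))"
    if "openin E \<Theta>" for \<Theta>
    unfolding uminus_le_liminf_iff m[OF openin_borel_of[OF that]]
    using True by (subst log_prob_ge_iff) (auto simp: enn2ereal_INF_less_iff)
  have dn: "ereal \<beta> < enn2ereal (INF x\<in>S. I x) \<longleftrightarrow> (\<exists>\<beta>'>\<beta>. \<forall>x\<in>S. ereal \<beta>' \<le> enn2ereal (I x))" for \<beta> S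
  proof
    assume "ereal \<beta> < enn2ereal (INF x\<in>S. I x)"
    then obtain r where r: "ereal \<beta> < ereal r" "ereal r < enn2ereal (INF x\<in>S. I x)" using ereal_dense2 by blast
    then have "\<forall>x\<in>S. ereal r \<le> enn2ereal (I x)" unfolding le_enn2ereal_INF_iff[symmetric] by simp
    with r show "\<exists>\<beta>'>\<beta>. \<forall>x\<in>S. ereal \<beta>' \<le> enn2ereal (I x)" by auto
  next
    assume "\<exists>\<beta>'>\<beta>. \<forall>x\<in>S. ereal \<beta>' \<le> enn2ereal (I x)"
    then obtain r where r: "r > \<beta>" "ereal r \<le> enn2ereal (INF x\<in>S. I x)" 
      unfolding le_enn2ereal_INF_iff by blast
    then show "ereal \<beta> < enn2ereal (INF x\<in>S. I x)" by (metis less_ereal.simps(1) less_le_trans)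
  qed
  have up: "limsup (\<lambda>n. ereal (1 / \<gamma> n) * log_prob (measure (distr M (borel_of E) (X n)) \<Gamma>))
        \<le> - enn2ereal (INF x\<in>\<Gamma>. I x) \<longleftrightarrow>
     (\<forall>\<beta> \<beta>'. \<beta> < \<beta>' \<longrightarrow> (\<forall>x\<in>\<Gamma>. ereal \<beta>' \<le> enn2ereal (I x)) \<longrightarrow>
      (\<forall>\<^sub>F n in sequentially. measure M {\<omega> \<in> space M. X n \<omega> \<in> \<Gamma>} \<le> exp (- (\<gamma> n * \<beta>))))"
    if "closedin E \<Gamma>" for \<Gamma>
    unfolding limsup_le_uminus_iff m[OF closedin_borel_of[OF that]] dn
    using True by (subst log_prob_le_iff) auto
  show ?thesis
    unfolding random_LDP_def LDP_def using True ps lo up by (simp cong: imp_cong)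
qed

lemma random_LDP_lowerD:
  assumes "prob_space M" "random_LDP M E X \<gamma> I" "openin E \<Theta>" "x \<in> \<Theta>" "enn2ereal (I x) < ereal \<beta>"
  shows "\<forall>\<^sub>F n in sequentially. exp (- (\<gamma> n * \<beta>)) \<le> measure M {\<omega> \<in> space M. X n \<omega> \<in> \<Theta>}"
  using random_LDP_iff[THEN iffD1, OF assms(1,2), THEN conjunct2, THEN conjunct2, THEN conjunct2, THEN conjunct2,
      THEN conjunct1, rule_format, OF assms(3-5)] .

lemma random_LDP_upperD:
  assumes "prob_space M" "random_LDP M E X \<gamma> I" "closedin E \<Gamma>" "\<beta> < \<beta>'"
    "\<And>x. x \<in> \<Gamma> \<Longrightarrow> ereal \<beta>' \<le> enn2ereal (I x)"
  shows "\<forall>\<^sub>F n in sequentially. measure M {\<omega> \<in> space M. X n \<omega> \<in> \<Gamma>} \<le> exp (- (\<gamma> n * \<beta>))"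
  using random_LDP_iff[THEN iffD1, OF assms(1,2), THEN conjunct2, THEN conjunct2, THEN conjunct2, THEN conjunct2,
      THEN conjunct2, rule_format, OF assms(3-5)] .

section \<open>Measurability with respect to Borel sets of a topology\<close>

lemma vimage_Int_space: "f -` S \<inter> space M = {\<omega> \<in> space M. f \<omega> \<in> S}"
  by auto

lemma measurable_borel_ofI:
  assumes "\<And>\<omega>. \<omega> \<in> space M \<Longrightarrow> f \<omega> \<in> topspace E"
    and "\<And>\<Theta>. openin E \<Theta> \<Longrightarrow> {\<omega> \<in> space M. f \<omega> \<in> \<Theta>} \<in> sets M"
  shows "f \<in> measurable M (borel_of E)"
  unfolding borel_of_def
proof (rule measurable_measure_of)
  fix y assume "y \<in> {\<Theta>. openin E \<Theta>}"
  then show "f -` y \<inter> space M \<in> sets M"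
    using assms(2)[of y] unfolding vimage_Int_space by simp
next
  show "{\<Theta>. openin E \<Theta>} \<subseteq> Pow (topspace E)" by (auto dest: openin_subset)
  show "f \<in> space M \<rightarrow> topspace E" using assms(1) by (rule Pi_I)
qed

lemma measurable_borel_of_topspace:
  "f \<in> measurable M (borel_of E) \<Longrightarrow> \<omega> \<in> space M \<Longrightarrow> f \<omega> \<in> topspace E"
  using measurable_space[of f M "borel_of E" \<omega>] by simp

lemma measurable_borel_of_Collect:
  assumes "f \<in> measurable M (borel_of E)" "S \<in> sets (borel_of E)"
  shows "{\<omega> \<in> space M. f \<omega> \<in> S} \<in> sets M"
  using measurable_sets[OF assms] unfolding vimage_Int_space .

lemma sets_borel_of_euclidean: "sets (borel_of euclidean) = sets borel"
  by (simp add: sets_borel_of borel_def)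

lemma continuous_map_measurable_borel_of:
  assumes "continuous_map E F f"
  shows "f \<in> measurable (borel_of E) (borel_of F)"
proof (rule measurable_borel_ofI)
  show "\<omega> \<in> space (borel_of E) \<Longrightarrow> f \<omega> \<in> topspace F" for \<omega>
    using assms by (auto simp: continuous_map_def)
  show "{\<omega> \<in> space (borel_of E). f \<omega> \<in> \<Theta>} \<in> sets (borel_of E)" if "openin F \<Theta>" for \<Theta>
    using openin_borel_of[OF openin_continuous_map_preimage[OF assms that]] by simp
qed

lemma openin_prod_topology_rectangleE:
  assumes "openin (prod_topology E F) \<Theta>" "(x, y) \<in> \<Theta>"
  obtains U V where "openin E U" "openin F V" "x \<in> U" "y \<in> V" "U \<times> V \<subseteq> \<Theta>"
  using assms(1)[unfolded openin_prod_topology_alt, rule_format, OF assms(2)] that by blast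

text \<open>Countability of a base of one factor suffices: an open set \<open>\<Theta>\<close> is the union, over the basic sets \<open>V\<close> of
the second factor, of \<open>G V \<times> V\<close>, where \<open>G V\<close> is the largest open set with \<open>G V \<times> V \<subseteq> \<Theta>\<close>.\<close>

lemma measurable_Pair_borel_of:
  assumes F: "second_countable F"
    and Y: "Y \<in> measurable M (borel_of E)" and W: "W \<in> measurable M (borel_of F)"
  shows "(\<lambda>\<omega>. (Y \<omega>, W \<omega>)) \<in> measurable M (borel_of (prod_topology E F))"
proof (rule measurable_borel_ofI)
  show "(Y \<omega>, W \<omega>) \<in> topspace (prod_topology E F)" if "\<omega> \<in> space M" for \<omega>
    using measurable_borel_of_topspace[OF Y that] measurable_borel_of_topspace[OF W that] by simp
next
  fix \<Theta> assume \<Theta>: "openin (prod_topology E F) \<Theta>"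
  from F[unfolded second_countable_def]
  obtain \<B> where \<B>: "countable \<B>" "\<forall>V\<in>\<B>. openin F V"
    "\<forall>U y. openin F U \<and> y \<in> U \<longrightarrow> (\<exists>V\<in>\<B>. y \<in> V \<and> V \<subseteq> U)"
    by (elim exE conjE)
  define G where "G V = \<Union>{U. openin E U \<and> U \<times> V \<subseteq> \<Theta>}" for V
  have G: "openin E (G V)" for V unfolding G_def by auto
  have eq: "\<Theta> = (\<Union>V\<in>\<B>. G V \<times> V)"
  proof
    show "\<Theta> \<subseteq> (\<Union>V\<in>\<B>. G V \<times> V)"
    proof
      fix z assume "z \<in> \<Theta>"
      then have "(fst z, snd z) \<in> \<Theta>" by simp
      from openin_prod_topology_rectangleE[OF \<Theta> this]
      obtain U V where UV: "openin E U" "openin F V" "fst z \<in> U" "snd z \<in> V" "U \<times> V \<subseteq> \<Theta>" .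
      from \<B>(3)[rule_format, OF conjI, OF UV(2,4)] obtain V' where "V' \<in> \<B>" "snd z \<in> V'" "V' \<subseteq> V" by auto
      moreover have "fst z \<in> G V'" unfolding G_def using UV \<open>V' \<subseteq> V\<close> by blast
      ultimately show "z \<in> (\<Union>V\<in>\<B>. G V \<times> V)" by (metis UN_iff mem_Times_iff)
    qed
    show "(\<Union>V\<in>\<B>. G V \<times> V) \<subseteq> \<Theta>" unfolding G_def by auto
  qed
  have "{\<omega> \<in> space M. (Y \<omega>, W \<omega>) \<in> \<Theta>} =
    (\<Union>V\<in>\<B>. {\<omega> \<in> space M. Y \<omega> \<in> G V} \<inter> {\<omega> \<in> space M. W \<omega> \<in> V})"
    unfolding eq by auto
  also have "\<dots> \<in> sets M"
    using \<B>(1) by (rule sets.countable_UN'')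
      (intro sets.Int measurable_borel_of_Collect[OF Y] measurable_borel_of_Collect[OF W]
        openin_borel_of G \<B>(2)[rule_format])
  finally show "{\<omega> \<in> space M. (Y \<omega>, W \<omega>) \<in> \<Theta>} \<in> sets M" .
qed

section \<open>Good rate functions and the contraction principle\<close>

lemma rate_function_closedin:
  assumes "rate_function E I" shows "closedin E {x \<in> topspace E. I x \<le> a}"
proof -
  have "topspace E - {x \<in> topspace E. I x \<le> a} = {x \<in> topspace E. a < I x}" by auto
  then show ?thesis using assms by (simp add: closedin_def rate_function_def)
qed

lemma rate_function_openin_ereal:
  assumes "rate_function E I" shows "openin E {x \<in> topspace E. u < enn2ereal (I x)}"
proof (cases "u < 0")
  case True
  then have "{x \<in> topspace E. u < enn2ereal (I x)} = topspace E"
    using less_le_trans[OF _ enn2ereal_nonneg] by blast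
  then show ?thesis by simp
next
  case False
  then obtain d where d: "u = enn2ereal d" by (metis enn2ereal_e2ennreal not_less)
  show ?thesis using assms unfolding d less_ennreal.rep_eq[symmetric] rate_function_def by auto
qed

text \<open>Bounds on a sum of rate functions are split into bounds on the summands. The split takes place
in the extended reals because a summand that vanishes leaves room only for a negative bound.\<close>

lemma less_ereal_addE:
  fixes p q :: ereal and c :: real
  assumes "ereal c < p + q" "0 \<le> p" "0 \<le> q"
  obtains u v :: real where "ereal u < p" "ereal v < q" "c \<le> u + v"
proof (cases p; cases q)
  fix r s assume pq: "p = ereal r" "q = ereal s"
  with assms have "c < r + s" by simp
  then show thesis
    by (intro that[of "r - (r + s - c) / 2" "s - (r + s - c) / 2"]) (auto simp: pq field_simps)
next
  fix r assume "p = ereal r" "q = \<infinity>"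
  then show thesis using that[of "r - 1" "c - r + 1"] by auto
next
  fix s assume "p = \<infinity>" "q = ereal s"
  then show thesis using that[of "c - s + 1" "s - 1"] by auto
next
  assume "p = \<infinity>" "q = \<infinity>"
  then show thesis using that[of "c" "0"] by auto
qed (use assms in auto)

lemma rate_function_sum:
  assumes I: "rate_function E I" and J: "rate_function F J"
  shows "rate_function (prod_topology E F) (\<lambda>(x, y). I x + J y)"
  unfolding rate_function_def
proof
  fix a :: ennreal
  let ?S = "{z \<in> topspace (prod_topology E F). a < (case z of (x, y) \<Rightarrow> I x + J y)}"
  show "openin (prod_topology E F) ?S"
  proof (subst openin_subopen, intro ballI)
    fix z assume z: "z \<in> ?S"
    obtain x y where xy: "z = (x, y)" by force
    have "a \<noteq> \<infinity>" using z by auto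
    then obtain c where c: "a = ennreal c" "0 \<le> c" by (cases a) auto
    have "ereal c < enn2ereal (I x) + enn2ereal (J y)"
      using z c by (simp add: xy less_ennreal.rep_eq plus_ennreal.rep_eq)
    from less_ereal_addE[OF this enn2ereal_nonneg enn2ereal_nonneg]
    obtain u v where uv: "ereal u < enn2ereal (I x)" "ereal v < enn2ereal (J y)" "c \<le> u + v" .
    let ?G = "{x \<in> topspace E. ereal u < enn2ereal (I x)}"
    let ?H = "{y \<in> topspace F. ereal v < enn2ereal (J y)}"
    have "openin (prod_topology E F) (?G \<times> ?H)"
      using assms by (simp add: openin_prod_Times_iff rate_function_openin_ereal)
    moreover have "z \<in> ?G \<times> ?H" using z uv by (simp add: xy)
    moreover have "?G \<times> ?H \<subseteq> ?S"
    proof clarify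
      fix x' y' assume *: "x' \<in> topspace E" "y' \<in> topspace F"
        "ereal u < enn2ereal (I x')" "ereal v < enn2ereal (J y')"
      have "ereal c \<le> ereal u + ereal v" using uv(3) by simp
      also have "\<dots> < enn2ereal (I x') + enn2ereal (J y')"
        using *(3,4) by (intro ereal_add_strict_mono2)
      finally show "(x', y') \<in> topspace (prod_topology E F) \<and> a < I x' + J y'"
        using * c by (simp add: less_ennreal.rep_eq plus_ennreal.rep_eq)
    qed
    ultimately show "\<exists>T. openin (prod_topology E F) T \<and> z \<in> T \<and> T \<subseteq> ?S" by blast
  qed
qed

lemma good_rate_function_sum:
  assumes I: "good_rate_function E I" and J: "good_rate_function F J"
  shows "good_rate_function (prod_topology E F) (\<lambda>(x, y). I x + J y)"
  unfolding good_rate_function_def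
proof (intro conjI allI impI)
  show rate: "rate_function (prod_topology E F) (\<lambda>(x, y). I x + J y)"
    using assms by (simp add: good_rate_function_def rate_function_sum)
  fix a :: real assume a: "0 \<le> a"
  have "compactin (prod_topology E F) ({x \<in> topspace E. I x \<le> ennreal a} \<times> {y \<in> topspace F. J y \<le> ennreal a})"
    using assms a by (auto simp: compactin_Times good_rate_function_def)
  moreover have "{z \<in> topspace (prod_topology E F). (case z of (x, y) \<Rightarrow> I x + J y) \<le> ennreal a}
     \<subseteq> {x \<in> topspace E. I x \<le> ennreal a} \<times> {y \<in> topspace F. J y \<le> ennreal a}"
    by (auto elim: order_trans[rotated] simp: add_increasing add_increasing2)
  ultimately show "compactin (prod_topology E F)
      {z \<in> topspace (prod_topology E F). (case z of (x, y) \<Rightarrow> I x + J y) \<le> ennreal a}"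
    using rate_function_closedin[OF rate] by (rule closed_compactin)
qed

lemma compactin_finite_subcoverE:
  assumes "compactin X S" "\<And>U. U \<in> \<U> \<Longrightarrow> openin X U" "S \<subseteq> \<Union>\<U>"
  obtains \<F> where "finite \<F>" "\<F> \<subseteq> \<U>" "S \<subseteq> \<Union>\<F>"
proof -
  have "\<exists>\<F>. finite \<F> \<and> \<F> \<subseteq> \<U> \<and> S \<subseteq> \<Union>\<F>"
    using assms(1)[unfolded compactin_def, THEN conjunct2, THEN spec, of \<U>] assms(2,3) by simp
  then show thesis using that by (elim exE conjE)
qed

text \<open>Otherwise the open sets \<open>{b < I}\<close> with \<open>b > a\<close> would cover the compact set \<open>C \<inter> {I \<le> a + 1}\<close>; a finite
subcover then bounds \<open>I\<close> on \<open>C\<close> away from \<open>a\<close>.\<close>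

lemma good_rate_function_attains_INF:
  assumes I: "good_rate_function E I" and C: "closedin E C"
    and a: "0 \<le> a" "(INF x\<in>C. I x) \<le> ennreal a"
  shows "\<exists>x\<in>C. I x \<le> ennreal a"
proof (rule ccontr)
  assume "\<not> ?thesis"
  then have gt: "ennreal a < I x" if "x \<in> C" for x using that by (simp add: not_le)
  let ?K = "C \<inter> {x \<in> topspace E. I x \<le> ennreal (a + 1)}"
  let ?U = "\<lambda>b. {x \<in> topspace E. b < I x}"
  have "compactin E {x \<in> topspace E. I x \<le> ennreal (a + 1)}"
    using I[unfolded good_rate_function_def, THEN conjunct2, rule_format, of "a + 1"] a(1) by linarith
  with C have "compactin E ?K" by (rule closed_Int_compactin)
  moreover have "openin E U" if "U \<in> ?U ` {ennreal a<..}" for U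
    using I that by (auto simp: good_rate_function_def rate_function_def)
  moreover have "?K \<subseteq> \<Union>(?U ` {ennreal a<..})"
  proof
    fix x assume x: "x \<in> ?K"
    then obtain b where "ennreal a < b" "b < I x" using gt dense by blast
    with x show "x \<in> \<Union>(?U ` {ennreal a<..})" by blast
  qed
  ultimately obtain \<F> where \<F>: "finite \<F>" "\<F> \<subseteq> ?U ` {ennreal a<..}" "?K \<subseteq> \<Union>\<F>"
    by (rule compactin_finite_subcoverE)
  from finite_subset_image[OF \<F>(1,2)]
  obtain R where R: "finite R" "R \<subseteq> {ennreal a<..}" "?K \<subseteq> (\<Union>b\<in>R. ?U b)"
    using \<F>(3) by blast
  define m where "m = Min (insert (ennreal (a + 1)) R)"
  have "m > ennreal a" unfolding m_def using R a(1) by (auto simp: ennreal_less_iff)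
  moreover have "m \<le> I x" if "x \<in> C" for x
  proof (cases "I x \<le> ennreal (a + 1)")
    case True
    then have "x \<in> ?K" using \<open>x \<in> C\<close> closedin_subset[OF C] by blast
    then obtain b where "b \<in> R" "b < I x" using R(3) by blast
    moreover have "m \<le> b" unfolding m_def using R(1) \<open>b \<in> R\<close> by simp
    ultimately show ?thesis by simp
  next
    case False
    moreover have "m \<le> ennreal (a + 1)" unfolding m_def using R(1) by simp
    ultimately show ?thesis by simp
  qed
  ultimately have "ennreal a < (INF x\<in>C. I x)" using INF_greatest less_le_trans by metis
  then show False using a(2) by simp
qed

text \<open>The contraction principle. Because infima of a good rate function over closed sets are attained,
the sublevel sets of \<open>I'\<close> are the images of those of \<open>I\<close>, hence compact.\<close>

locale rate_contraction =
  fixes E :: "'a topology" and F :: "'b topology" and f :: "'a \<Rightarrow> 'b"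
    and I :: "'a \<Rightarrow> ennreal" and I' :: "'b \<Rightarrow> ennreal"
  assumes f: "continuous_map E F f" and F: "Hausdorff_space F"
    and I: "good_rate_function E I"
    and I': "\<And>y. y \<in> topspace F \<Longrightarrow> I' y = (INF x\<in>{x \<in> topspace E. f x = y}. I x)"
begin

lemma sublevel_image:
  assumes "0 \<le> a"
  shows "{y \<in> topspace F. I' y \<le> ennreal a} = f ` {x \<in> topspace E. I x \<le> ennreal a}"
proof
  show "f ` {x \<in> topspace E. I x \<le> ennreal a} \<subseteq> {y \<in> topspace F. I' y \<le> ennreal a}"
  proof clarify
    fix x assume x: "x \<in> topspace E" "I x \<le> ennreal a"
    then have y: "f x \<in> topspace F" using f by (auto simp: continuous_map_def)
    have "I' (f x) \<le> I x" unfolding I'[OF y] using x by (intro INF_lower) auto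
    with x y show "f x \<in> topspace F \<and> I' (f x) \<le> ennreal a" by auto
  qed
  show "{y \<in> topspace F. I' y \<le> ennreal a} \<subseteq> f ` {x \<in> topspace E. I x \<le> ennreal a}"
  proof clarify
    fix y assume y: "y \<in> topspace F" "I' y \<le> ennreal a"
    have "closedin F {y}" using F y(1) by (simp add: Hausdorff_imp_t1_space closedin_t1_singleton)
    then have "closedin E {x \<in> topspace E. f x \<in> {y}}" by (rule closedin_continuous_map_preimage[OF f])
    from good_rate_function_attains_INF[OF I this assms] y
    show "y \<in> f ` {x \<in> topspace E. I x \<le> ennreal a}" unfolding I'[OF y(1)] by auto
  qed
qed

lemma contraction_good: "good_rate_function F I'"
proof -
  have comp: "compactin F {y \<in> topspace F. I' y \<le> ennreal a}" if "0 \<le> a" for a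
    unfolding sublevel_image[OF that]
    using I that f by (auto simp: good_rate_function_def intro: image_compactin)
  have "openin F {y \<in> topspace F. a < I' y}" for a
  proof (cases a)
    case (real r)
    have "{y \<in> topspace F. a < I' y} = topspace F - {y \<in> topspace F. I' y \<le> ennreal r}"
      using real by auto
    then show ?thesis using compactin_imp_closedin[OF F comp] real by (simp add: closedin_def)
  qed simp
  with comp show ?thesis by (simp add: good_rate_function_def rate_function_def)
qed

lemma contraction_LDP:
  assumes M: "prob_space M" and X: "random_LDP M E X \<gamma> I"
  shows "random_LDP M F (\<lambda>n \<omega>. f (X n \<omega>)) \<gamma> I'"
proof -
  note iff = random_LDP_iff[OF M]
    have Xm: "X n \<in> measurable M (borel_of E)" for n using X unfolding iff by blast
  have eq: "{\<omega> \<in> space M. f (X n \<omega>) \<in> S} = {\<omega> \<in> space M. X n \<omega> \<in> {x \<in> topspace E. f x \<in> S}}" for n S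
    using measurable_borel_of_topspace[OF Xm] by auto
  show ?thesis unfolding iff
  proof (intro conjI allI impI)
    show "(\<lambda>\<omega>. f (X n \<omega>)) \<in> measurable M (borel_of F)" for n
      using Xm continuous_map_measurable_borel_of[OF f] by (rule measurable_compose)
    show "rate_function F I'" using contraction_good by (simp add: good_rate_function_def)
  next
    fix \<Theta> y \<beta> assume \<Theta>: "openin F \<Theta>" "y \<in> \<Theta>" "enn2ereal (I' y) < ereal \<beta>"
    then have y: "y \<in> topspace F" using openin_subset by blast
    with \<Theta>(3) obtain x where "x \<in> topspace E" "f x = y" "enn2ereal (I x) < ereal \<beta>"
      using enn2ereal_INF_less_iff[of I "{x \<in> topspace E. f x = y}"] by (auto simp: I'[OF y])
    then show "\<forall>\<^sub>F n in sequentially. exp (- (\<gamma> n * \<beta>)) \<le> measure M {\<omega> \<in> space M. f (X n \<omega>) \<in> \<Theta>}"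
      unfolding eq using \<Theta>(2)
      by (intro random_LDP_lowerD[OF M X openin_continuous_map_preimage[OF f \<Theta>(1)]]) auto
  next
    fix \<Gamma> \<beta> \<beta>' assume \<Gamma>: "closedin F \<Gamma>" "\<beta> < \<beta>'" "\<forall>y\<in>\<Gamma>. ereal \<beta>' \<le> enn2ereal (I' y)"
    have "ereal \<beta>' \<le> enn2ereal (I x)" if "x \<in> topspace E" "f x \<in> \<Gamma>" for x
    proof -
      have y: "f x \<in> topspace F" using f that by (auto simp: continuous_map_def)
      have "I' (f x) \<le> I x" unfolding I'[OF y] using that by (intro INF_lower) auto
      with \<Gamma>(3) that show ?thesis by (meson less_eq_ennreal.rep_eq order_trans)
    qed
    then show "\<forall>\<^sub>F n in sequentially. measure M {\<omega> \<in> space M. f (X n \<omega>) \<in> \<Gamma>} \<le> exp (- (\<gamma> n * \<beta>))"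
      unfolding eq
      by (intro random_LDP_upperD[OF M X closedin_continuous_map_preimage[OF f \<Gamma>(1)] \<Gamma>(2)]) auto
  qed (use X in \<open>auto simp: iff\<close>)
qed

end

section \<open>Large deviations of independent pairs\<close>

text \<open>Exponential decay at rate at least \<open>b\<close> with speed \<open>\<gamma>\<close>. Only exponents strictly below \<open>b\<close> are required,
which makes the notion stable under finite sums, where a factor is lost.\<close>

definition exp_small :: "(nat \<Rightarrow> real) \<Rightarrow> real \<Rightarrow> (nat \<Rightarrow> real) \<Rightarrow> bool" where
  "exp_small \<gamma> b p \<longleftrightarrow> (\<forall>\<beta><b. \<forall>\<^sub>F n in sequentially. p n \<le> exp (- (\<gamma> n * \<beta>)))"

lemma exp_small_mono:
  assumes "exp_small \<gamma> b q" "\<And>n. p n \<le> q n" "b' \<le> b"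
  shows "exp_small \<gamma> b' p"
  unfolding exp_small_def
proof (intro allI impI)
  fix \<beta> assume "\<beta> < b'"
  then have "\<forall>\<^sub>F n in sequentially. q n \<le> exp (- (\<gamma> n * \<beta>))"
    using assms(1,3) by (auto simp: exp_small_def)
  then show "\<forall>\<^sub>F n in sequentially. p n \<le> exp (- (\<gamma> n * \<beta>))"
    by (rule eventually_mono) (use assms(2) order_trans in blast)
qed

lemma exp_small_add:
  assumes \<gamma>: "filterlim \<gamma> at_top sequentially" and p: "exp_small \<gamma> b p" and q: "exp_small \<gamma> b q"
  shows "exp_small \<gamma> b (\<lambda>n. p n + q n)"
  unfolding exp_small_def
proof (intro allI impI)
  fix \<beta> assume "\<beta> < b"
  define m where "m = (\<beta> + b) / 2"
  have m: "\<beta> < m" "m < b" using \<open>\<beta> < b\<close> by (auto simp: m_def)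
  have "\<forall>\<^sub>F n in sequentially. p n \<le> exp (- (\<gamma> n * m))" "\<forall>\<^sub>F n in sequentially. q n \<le> exp (- (\<gamma> n * m))"
    "\<forall>\<^sub>F n in sequentially. ln 2 / (m - \<beta>) \<le> \<gamma> n"
    using p q m \<gamma> by (auto simp: exp_small_def filterlim_at_top)
  then show "\<forall>\<^sub>F n in sequentially. p n + q n \<le> exp (- (\<gamma> n * \<beta>))"
  proof eventually_elim
    case (elim n)
    have "ln 2 \<le> \<gamma> n * (m - \<beta>)" using elim(3) m by (simp add: field_simps)
    then have "2 \<le> exp (\<gamma> n * (m - \<beta>))" by (metis exp_le_cancel_iff exp_ln zero_less_numeral)
    then have "2 * exp (- (\<gamma> n * m)) \<le> exp (\<gamma> n * (m - \<beta>)) * exp (- (\<gamma> n * m))"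
      by (intro mult_right_mono) auto
    also have "\<dots> = exp (- (\<gamma> n * \<beta>))" by (simp add: exp_add[symmetric] algebra_simps)
    finally show ?case using elim by linarith
  qed
qed

lemma exp_small_mult:
  assumes "exp_small \<gamma> u p" "exp_small \<gamma> v q" "\<And>n. 0 \<le> p n" "\<And>n. 0 \<le> q n"
  shows "exp_small \<gamma> (u + v) (\<lambda>n. p n * q n)"
  unfolding exp_small_def
proof (intro allI impI)
  fix \<beta> assume "\<beta> < u + v"
  define d where "d = (u + v - \<beta>) / 2"
  have d: "u - d < u" "v - d < v" "(u - d) + (v - d) = \<beta>" using \<open>\<beta> < u + v\<close> by (auto simp: d_def field_simps)
  have "\<forall>\<^sub>F n in sequentially. p n \<le> exp (- (\<gamma> n * (u - d)))" "\<forall>\<^sub>F n in sequentially. q n \<le> exp (- (\<gamma> n * (v - d)))"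
    using assms(1,2) d(1,2) by (auto simp: exp_small_def)
  then show "\<forall>\<^sub>F n in sequentially. p n * q n \<le> exp (- (\<gamma> n * \<beta>))"
  proof eventually_elim
    case (elim n)
    have "p n * q n \<le> exp (- (\<gamma> n * (u - d))) * exp (- (\<gamma> n * (v - d)))"
      using elim assms(3,4) by (intro mult_mono) auto
    also have "\<dots> = exp (- (\<gamma> n * \<beta>))" unfolding d(3)[symmetric] by (simp add: exp_add[symmetric] algebra_simps)
    finally show ?case .
  qed
qed

text \<open>Goodness of both rate functions takes the place of exponential tightness, see the beginning.
Regularity provides, around each point, a rectangle whose closed hull still lies in the sets where the
two rate functions are large, so that the upper bounds for closed sets apply to it.\<close>

lemma product_LDP:
  assumes M: "prob_space M" and EF: "regular_space E" "regular_space F" and F: "second_countable F"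
    and Y: "random_LDP M E Y \<gamma> I" "good_rate_function E I"
    and W: "random_LDP M F W \<gamma> J" "good_rate_function F J"
    and indep: "\<And>n S S'. S \<in> sets (borel_of E) \<Longrightarrow> S' \<in> sets (borel_of F) \<Longrightarrow>
      measure M {\<omega> \<in> space M. Y n \<omega> \<in> S \<and> W n \<omega> \<in> S'} =
      measure M {\<omega> \<in> space M. Y n \<omega> \<in> S} * measure M {\<omega> \<in> space M. W n \<omega> \<in> S'}"
  shows "random_LDP M (prod_topology E F) (\<lambda>n \<omega>. (Y n \<omega>, W n \<omega>)) \<gamma> (\<lambda>(x, y). I x + J y)"
proof -
  interpret prob_space M by fact
  note iff = random_LDP_iff[OF M]
  note LY = Y(1)[unfolded iff] and LW = W(1)[unfolded iff]
  have Ym: "Y n \<in> measurable M (borel_of E)" and Wm: "W n \<in> measurable M (borel_of F)" for n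
    using LY LW by auto
  have YWm: "(\<lambda>\<omega>. (Y n \<omega>, W n \<omega>)) \<in> measurable M (borel_of (prod_topology E F))" for n
    using F Ym Wm by (rule measurable_Pair_borel_of)
  have \<gamma>: "\<And>n. 0 < \<gamma> n" "filterlim \<gamma> at_top sequentially" using LY by auto
  let ?EF = "prod_topology E F"
  define P where "P n S = measure M {\<omega> \<in> space M. (Y n \<omega>, W n \<omega>) \<in> S}" for n S
  have P_rect: "P n (S \<times> S') = measure M {\<omega> \<in> space M. Y n \<omega> \<in> S} * measure M {\<omega> \<in> space M. W n \<omega> \<in> S'}"
    if "S \<in> sets (borel_of E)" "S' \<in> sets (borel_of F)" for n S S'
    unfolding P_def indep[OF that, symmetric] by simp
  have ev: "{\<omega> \<in> space M. (Y n \<omega>, W n \<omega>) \<in> S} \<in> sets M" if "S \<in> sets (borel_of ?EF)" for n S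
    using measurable_borel_of_Collect[OF YWm that] .
  have P_mono: "P n S \<le> P n S'" if "S \<inter> topspace ?EF \<subseteq> S'" "S' \<in> sets (borel_of ?EF)" for n S S'
    unfolding P_def
  proof (rule finite_measure_mono)
    show "{\<omega> \<in> space M. (Y n \<omega>, W n \<omega>) \<in> S} \<subseteq> {\<omega> \<in> space M. (Y n \<omega>, W n \<omega>) \<in> S'}"
      using that(1) measurable_borel_of_topspace[OF YWm] by blast
  qed (rule ev[OF that(2)])
  have P_Un: "P n (S \<union> S') \<le> P n S + P n S'" if "S \<in> sets (borel_of ?EF)" "S' \<in> sets (borel_of ?EF)" for n S S'
  proof -
    have "{\<omega> \<in> space M. (Y n \<omega>, W n \<omega>) \<in> S \<union> S'} =
      {\<omega> \<in> space M. (Y n \<omega>, W n \<omega>) \<in> S} \<union> {\<omega> \<in> space M. (Y n \<omega>, W n \<omega>) \<in> S'}" by auto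
    then show ?thesis unfolding P_def using measure_Un_le[OF ev[OF that(1)] ev[OF that(2)]] by simp
  qed
  have small_Y: "exp_small \<gamma> u (\<lambda>n. measure M {\<omega> \<in> space M. Y n \<omega> \<in> C})"
    if "closedin E C" "\<And>x. x \<in> C \<Longrightarrow> ereal u \<le> enn2ereal (I x)" for C u
    unfolding exp_small_def by (intro allI impI random_LDP_upperD[OF M Y(1) that(1)]) (assumption, erule that(2))
  have small_W: "exp_small \<gamma> u (\<lambda>n. measure M {\<omega> \<in> space M. W n \<omega> \<in> C})"
    if "closedin F C" "\<And>x. x \<in> C \<Longrightarrow> ereal u \<le> enn2ereal (J x)" for C u
    unfolding exp_small_def by (intro allI impI random_LDP_upperD[OF M W(1) that(1)]) (assumption, erule that(2))
  show ?thesis unfolding iff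
  proof (intro conjI allI impI)
    show "(\<lambda>\<omega>. (Y n \<omega>, W n \<omega>)) \<in> measurable M (borel_of ?EF)" for n by (rule YWm)
    show "rate_function ?EF (\<lambda>(x, y). I x + J y)" using LY LW by (intro rate_function_sum) auto
  next
    fix \<Theta> z \<beta> assume \<Theta>: "openin ?EF \<Theta>" "z \<in> \<Theta>"
      and less: "enn2ereal (case z of (x, y) \<Rightarrow> I x + J y) < ereal \<beta>"
    obtain x y where z: "z = (x, y)" by force
    from openin_prod_topology_rectangleE[OF \<Theta>[unfolded z]]
    obtain U V where UV: "openin E U" "openin F V" "x \<in> U" "y \<in> V" "U \<times> V \<subseteq> \<Theta>" .
    have less': "enn2ereal (I x) + enn2ereal (J y) < ereal \<beta>"
      using less by (simp add: z plus_ennreal.rep_eq)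
    then obtain r s where rs: "enn2ereal (I x) = ereal r" "enn2ereal (J y) = ereal s"
      using enn2ereal_nonneg[of "I x"] enn2ereal_nonneg[of "J y"]
      by (cases "enn2ereal (I x)"; cases "enn2ereal (J y)") auto
    define d where "d = (\<beta> - r - s) / 2"
    have d: "0 < d" "(r + d) + (s + d) = \<beta>" using less' by (auto simp: rs d_def field_simps)
    have "\<forall>\<^sub>F n in sequentially. exp (- (\<gamma> n * (r + d))) \<le> measure M {\<omega> \<in> space M. Y n \<omega> \<in> U}"
      by (rule random_LDP_lowerD[OF M Y(1) UV(1,3)]) (simp add: rs d(1))
    moreover have "\<forall>\<^sub>F n in sequentially. exp (- (\<gamma> n * (s + d))) \<le> measure M {\<omega> \<in> space M. W n \<omega> \<in> V}"
      by (rule random_LDP_lowerD[OF M W(1) UV(2,4)]) (simp add: rs d(1))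
    ultimately show "\<forall>\<^sub>F n in sequentially. exp (- (\<gamma> n * \<beta>)) \<le>
        measure M {\<omega> \<in> space M. (Y n \<omega>, W n \<omega>) \<in> \<Theta>}"
    proof eventually_elim
      case (elim n)
      have "exp (- (\<gamma> n * \<beta>)) = exp (- (\<gamma> n * (r + d))) * exp (- (\<gamma> n * (s + d)))"
        unfolding d(2)[symmetric] by (simp add: exp_add[symmetric] algebra_simps)
      also have "\<dots> \<le> measure M {\<omega> \<in> space M. Y n \<omega> \<in> U} * measure M {\<omega> \<in> space M. W n \<omega> \<in> V}"
        using elim by (intro mult_mono) auto
      also have "\<dots> = P n (U \<times> V)" using UV by (simp add: P_rect openin_borel_of)
      also have "\<dots> \<le> P n \<Theta>" using UV(5) \<Theta>(1) by (intro P_mono openin_borel_of) auto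
      finally show ?case unfolding P_def .
    qed
  next
    fix \<Gamma> \<beta> \<beta>' assume \<Gamma>: "closedin ?EF \<Gamma>" and "\<beta> < \<beta>'"
      and ge: "\<forall>z\<in>\<Gamma>. ereal \<beta>' \<le> enn2ereal (case z of (x, y) \<Rightarrow> I x + J y)"
    obtain b where b: "\<beta> < b" "b < \<beta>'" using \<open>\<beta> < \<beta>'\<close> dense by blast
    show "\<forall>\<^sub>F n in sequentially. measure M {\<omega> \<in> space M. (Y n \<omega>, W n \<omega>) \<in> \<Gamma>} \<le> exp (- (\<gamma> n * \<beta>))"
    \<comment> \<open>A negative exponent gives no restriction, as probabilities are at most one.\<close>
    proof (cases "0 \<le> b")
      case False
      have "measure M {\<omega> \<in> space M. (Y n \<omega>, W n \<omega>) \<in> \<Gamma>} \<le> exp (- (\<gamma> n * \<beta>))" for n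
      proof -
        have "0 \<le> - (\<gamma> n * \<beta>)" using False b \<gamma>(1)[of n] by (simp add: mult_nonneg_nonpos)
        then have "1 \<le> exp (- (\<gamma> n * \<beta>))" by simp
        then show ?thesis using prob_le_1 order_trans by blast
      qed
      then show ?thesis by simp
    next
      case True
      define K where "K = {x \<in> topspace E. I x \<le> ennreal b}"
      define L where "L = {y \<in> topspace F. J y \<le> ennreal b}"
      have K: "compactin E K" and L: "compactin F L"
        using Y(2) W(2) True by (auto simp: good_rate_function_def K_def L_def)
      \<comment> \<open>The sets that meet \<open>\<Gamma>\<close> in something of the required exponential order are closed under finite unions, so compactness yields one that contains \<open>K \<times> L\<close>.\<close>
      define nice where "nice G \<longleftrightarrow> openin ?EF G \<and> exp_small \<gamma> b (\<lambda>n. P n (G \<inter> \<Gamma>))" for G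
      have meas: "G \<inter> \<Gamma> \<in> sets (borel_of ?EF)" if "openin ?EF G" for G
        using that \<Gamma> by (intro sets.Int openin_borel_of closedin_borel_of)
      have nice_empty: "nice {}"
        unfolding nice_def P_def exp_small_def by simp
      have nice_Un: "nice (G \<union> G')" if "nice G" "nice G'" for G G'
        unfolding nice_def
      proof
        show "openin ?EF (G \<union> G')" using that by (auto simp: nice_def)
        have "exp_small \<gamma> b (\<lambda>n. P n (G \<inter> \<Gamma>) + P n (G' \<inter> \<Gamma>))"
          using that by (intro exp_small_add \<gamma>) (auto simp: nice_def)
        moreover have "P n ((G \<union> G') \<inter> \<Gamma>) \<le> P n (G \<inter> \<Gamma>) + P n (G' \<inter> \<Gamma>)" for n
          using that by (subst Int_Un_distrib2) (intro P_Un meas; simp add: nice_def)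
        ultimately show "exp_small \<gamma> b (\<lambda>n. P n ((G \<union> G') \<inter> \<Gamma>))" by (rule exp_small_mono) simp
      qed
      have nice_nbhd: "\<exists>G. nice G \<and> z \<in> G" if "z \<in> K \<times> L" for z
      proof -
        obtain x y where z: "z = (x, y)" by force
        have xy: "x \<in> topspace E" "y \<in> topspace F" using that by (auto simp: z K_def L_def)
        show ?thesis
        proof (cases "z \<in> \<Gamma>")
          case False
          have "nice (topspace ?EF - \<Gamma>)"
            unfolding nice_def using \<Gamma> by (simp add: closedin_def Int_Diff Diff_Int_distrib P_def exp_small_def
                Diff_Int2 Diff_disjoint)
          then show ?thesis using False xy by (auto simp: z)
        next
          case True
          then have "ereal \<beta>' \<le> enn2ereal (I x) + enn2ereal (J y)"
            using ge by (auto simp: z plus_ennreal.rep_eq)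
          then have "ereal b < enn2ereal (I x) + enn2ereal (J y)"
            using b by (metis less_ereal.simps(1) less_le_trans)
          from less_ereal_addE[OF this enn2ereal_nonneg enn2ereal_nonneg]
          obtain u v where uv: "ereal u < enn2ereal (I x)" "ereal v < enn2ereal (J y)" "b \<le> u + v" .
          have "openin E {x \<in> topspace E. ereal u < enn2ereal (I x)}"
            "openin F {y \<in> topspace F. ereal v < enn2ereal (J y)}"
            using LY LW by (auto intro: rate_function_openin_ereal)
          then obtain U C V D where
            U: "openin E U" "closedin E C" "x \<in> U" "U \<subseteq> C" "C \<subseteq> {x \<in> topspace E. ereal u < enn2ereal (I x)}"
            and V: "openin F V" "closedin F D" "y \<in> V" "V \<subseteq> D" "D \<subseteq> {y \<in> topspace F. ereal v < enn2ereal (J y)}"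
            using EF uv xy unfolding neighbourhood_base_of_closedin[symmetric] neighbourhood_base_of
            by (metis (mono_tags, lifting) mem_Collect_eq)
          have "exp_small \<gamma> (u + v) (\<lambda>n. measure M {\<omega> \<in> space M. Y n \<omega> \<in> C} * measure M {\<omega> \<in> space M. W n \<omega> \<in> D})"
            using U V by (intro exp_small_mult small_Y small_W) (auto simp: less_imp_le)
          moreover have "P n ((U \<times> V) \<inter> \<Gamma>) \<le> measure M {\<omega> \<in> space M. Y n \<omega> \<in> C} * measure M {\<omega> \<in> space M. W n \<omega> \<in> D}" for n
          proof -
            have "P n ((U \<times> V) \<inter> \<Gamma>) \<le> P n (C \<times> D)"
              using U V by (intro P_mono closedin_borel_of) (auto simp: closedin_prod_Times_iff)
            then show ?thesis using U V by (simp add: P_rect closedin_borel_of)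
          qed
          ultimately have "exp_small \<gamma> b (\<lambda>n. P n ((U \<times> V) \<inter> \<Gamma>))" using uv(3) by (rule exp_small_mono)
          then have "nice (U \<times> V)" using U V by (auto simp: nice_def openin_prod_Times_iff)
          then show ?thesis using U V z by blast
        qed
      qed
      have "compactin ?EF (K \<times> L)" using K L by (simp add: compactin_Times)
      moreover have "openin ?EF G" if "G \<in> Collect nice" for G using that by (simp add: nice_def)
      moreover have "K \<times> L \<subseteq> \<Union>(Collect nice)" using nice_nbhd by blast
      ultimately obtain \<F> where \<F>: "finite \<F>" "\<F> \<subseteq> Collect nice" "K \<times> L \<subseteq> \<Union>\<F>"
        by (rule compactin_finite_subcoverE)
      have "nice (\<Union>\<F>)" using \<F>(1,2) by (induction \<F>) (auto intro: nice_empty nice_Un)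
      define G where "G = \<Union>\<F>"
      have G: "openin ?EF G" "exp_small \<gamma> b (\<lambda>n. P n (G \<inter> \<Gamma>))" "K \<times> L \<subseteq> G"
        using \<open>nice (\<Union>\<F>)\<close> \<F>(3) by (auto simp: nice_def G_def)
      \<comment> \<open>Outside \<open>U \<times> V\<close> one of the two coordinates leaves its sublevel set.\<close>
      from Wallace_theorem_prod_topology[OF K L G(1,3)]
      obtain U V where UV: "openin E U" "openin F V" "K \<subseteq> U" "L \<subseteq> V" "U \<times> V \<subseteq> G" .
      have cl: "closedin E (topspace E - U)" "closedin F (topspace F - V)" using UV by auto
      have "exp_small \<gamma> b (\<lambda>n. measure M {\<omega> \<in> space M. Y n \<omega> \<in> topspace E - U})"
      proof (rule small_Y[OF cl(1)])
        fix x assume "x \<in> topspace E - U"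
        then have "\<not> I x \<le> ennreal b" using UV(3) by (auto simp: K_def)
        then show "ereal b \<le> enn2ereal (I x)" using True by (simp add: less_eq_ennreal.rep_eq)
      qed
      moreover have "exp_small \<gamma> b (\<lambda>n. measure M {\<omega> \<in> space M. W n \<omega> \<in> topspace F - V})"
      proof (rule small_W[OF cl(2)])
        fix x assume "x \<in> topspace F - V"
        then have "\<not> J x \<le> ennreal b" using UV(4) by (auto simp: L_def)
        then show "ereal b \<le> enn2ereal (J x)" using True by (simp add: less_eq_ennreal.rep_eq)
      qed
      ultimately have "exp_small \<gamma> b (\<lambda>n. P n (G \<inter> \<Gamma>) + (measure M {\<omega> \<in> space M. Y n \<omega> \<in> topspace E - U}
          + measure M {\<omega> \<in> space M. W n \<omega> \<in> topspace F - V}))"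
        by (intro exp_small_add \<gamma> G)
      moreover have "P n \<Gamma> \<le> P n (G \<inter> \<Gamma>) + (measure M {\<omega> \<in> space M. Y n \<omega> \<in> topspace E - U}
          + measure M {\<omega> \<in> space M. W n \<omega> \<in> topspace F - V})" for n
      proof -
        let ?A = "(topspace E - U) \<times> topspace F" and ?B = "topspace E \<times> (topspace F - V)"
        have AB: "?A \<in> sets (borel_of ?EF)" "?B \<in> sets (borel_of ?EF)"
          using cl by (auto intro!: closedin_borel_of simp: closedin_prod_Times_iff)
        have "P n \<Gamma> \<le> P n ((G \<inter> \<Gamma>) \<union> (?A \<union> ?B))"
          using UV(5) by (intro P_mono sets.Un AB meas G) auto
        also have "\<dots> \<le> P n (G \<inter> \<Gamma>) + (P n ?A + P n ?B)"
          using P_Un[of "G \<inter> \<Gamma>" "?A \<union> ?B" n] P_Un[of ?A ?B n] AB meas[OF G(1)] by auto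
        also have "P n ?A = measure M {\<omega> \<in> space M. Y n \<omega> \<in> topspace E - U}"
          unfolding P_def using measurable_borel_of_topspace[OF Wm]
          by (intro arg_cong[where f="measure M"]) auto
        also have "P n ?B = measure M {\<omega> \<in> space M. W n \<omega> \<in> topspace F - V}"
          unfolding P_def using measurable_borel_of_topspace[OF Ym]
          by (intro arg_cong[where f="measure M"]) auto
        finally show ?thesis .
      qed
      ultimately have "exp_small \<gamma> b (\<lambda>n. P n \<Gamma>)" by (rule exp_small_mono) simp
      then show ?thesis using b(1) by (simp add: exp_small_def P_def)
    qed
  qed (use \<gamma> in auto)
qed

section \<open>The space of continuous paths\<close>

abbreviation path_metric :: "real \<Rightarrow> (real \<Rightarrow> 'a::metric_space) metric" where
  "path_metric T \<equiv> cfunspace (top_of_set {0..T}) euclidean_metric"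

text \<open>Describes the carrier without reference to the topology, so that the equation for the path space as
a metric topology is not circular.\<close>

definition paths :: "real \<Rightarrow> (real \<Rightarrow> 'a::metric_space) set" where
  "paths T = {f. f \<in> extensional {0..T} \<and> continuous_on {0..T} f}"

lemma mspace_path_metric: "mspace (path_metric T) = (paths T :: (real \<Rightarrow> 'a::metric_space) set)"
proof -
  have "compactin (top_of_set {0..T}) (topspace (top_of_set {0..T}))"
    by (simp add: compactin_subtopology)
  then show ?thesis
    unfolding paths_def by (subst compactin_mspace_cfunspace) auto
qed

lemma topspace_path_space: "topspace (path_space T) = (paths T :: (real \<Rightarrow> 'a::metric_space) set)"
  by (simp only: path_space_def topspace_mtopology_of mspace_path_metric)

lemma path_space_eq: "path_space T = Metric_space.mtopology (paths T) (mdist (path_metric T))"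
  by (simp only: path_space_def mtopology_of_def mspace_path_metric)

lemma Metric_space_path_space:
  "Metric_space (paths T :: (real \<Rightarrow> 'a::metric_space) set) (mdist (path_metric T))"
  using Metric_space_mspace_mdist[of "path_metric T"] by (simp only: mspace_path_metric)

lemma path_metric_less:
  fixes f g :: "real \<Rightarrow> 'a::metric_space"
  assumes "0 < e" "\<And>t. t \<in> {0..T} \<Longrightarrow> dist (f t) (g t) \<le> e / 2"
  shows "mdist (path_metric T) f g < e"
proof -
  have "mdist (path_metric T) f g \<le> e / 2"
    using assms by (intro mdist_cfunspace_le) auto
  then show ?thesis using assms(1) by linarith
qed

lemma dist_le_path_metric:
  fixes f g :: "real \<Rightarrow> 'a::metric_space"
  assumes "f \<in> paths T" "g \<in> paths T" "t \<in> {0..T}"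
  shows "dist (f t) (g t) \<le> mdist (path_metric T) f g"
proof -
  have "mdist euclidean_metric (f t) (g t) \<le> mdist (path_metric T) f g"
    using assms unfolding mspace_path_metric[symmetric]
    by (intro mdist_cfunspace_imp_mdist_le[OF _ _ order_refl]) simp_all
  then show ?thesis by simp
qed

lemma metrizable_path_space: "metrizable_space (path_space T :: (real \<Rightarrow> 'a::metric_space) topology)"
  unfolding path_space_eq[of T] by (rule Metric_space.metrizable_space_mtopology[OF Metric_space_path_space])

lemma path_space_neighbourhoodE:
  fixes f :: "real \<Rightarrow> 'a::metric_space"
  assumes "f \<in> paths T" "0 < e"
  obtains U where "openin (path_space T) U" "f \<in> U"
    "\<And>g t. g \<in> U \<Longrightarrow> t \<in> {0..T} \<Longrightarrow> dist (f t) (g t) < e"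
proof -
  interpret Metric_space "paths T :: (real \<Rightarrow> 'a) set" "mdist (path_metric T)"
    by (rule Metric_space_path_space)
  show thesis
  proof (rule that[of "mball f e"])
    show "openin (path_space T) (mball f e)" unfolding path_space_eq[of T] by (rule openin_mball)
    show "f \<in> mball f e" using assms by simp
    show "dist (f t) (g t) < e" if "g \<in> mball f e" "t \<in> {0..T}" for g t
    proof -
      have "g \<in> paths T" "mdist (path_metric T) f g < e" using that(1) by auto
      then show ?thesis using dist_le_path_metric[OF assms(1) _ that(2), of g] by linarith
    qed
  qed
qed

lemma continuous_map_into_path_space:
  fixes F :: "'b \<Rightarrow> real \<Rightarrow> 'a::metric_space"
  assumes "\<And>x. x \<in> topspace E \<Longrightarrow> F x \<in> paths T"
    and "\<And>x e. x \<in> topspace E \<Longrightarrow> 0 < e \<Longrightarrow>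
      \<exists>U. openin E U \<and> x \<in> U \<and> (\<forall>y\<in>U. \<forall>t\<in>{0..T}. dist (F x t) (F y t) \<le> e)"
  shows "continuous_map E (path_space T) F"
proof -
  interpret Metric_space "paths T :: (real \<Rightarrow> 'a) set" "mdist (path_metric T)"
    by (rule Metric_space_path_space)
  show ?thesis unfolding path_space_eq[of T] continuous_map_to_metric
  proof (intro ballI allI impI)
    fix x and e :: real assume x: "x \<in> topspace E" and "0 < e"
    then obtain U where U: "openin E U" "x \<in> U" "\<forall>y\<in>U. \<forall>t\<in>{0..T}. dist (F x t) (F y t) \<le> e / 2"
      using assms(2)[of x "e / 2"] by auto
    have "F y \<in> mball (F x) e" if "y \<in> U" for y
      using U(3) that \<open>0 < e\<close> assms(1)[OF x] assms(1)[of y] openin_subset[OF U(1)] path_metric_less[of e T "F x" "F y"]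
      by auto
    with U show "\<exists>U. openin E U \<and> x \<in> U \<and> (\<forall>y\<in>U. F y \<in> mball (F x) e)" by blast
  qed
qed

lemma second_countable_euclidean:
  "second_countable (euclidean :: 'a::second_countable_topology topology)"
proof -
  obtain B :: "'a set set" where B: "countable B" "topological_basis B"
    using ex_countable_basis by blast
  show ?thesis unfolding second_countable_def
  proof (intro exI[of _ B] conjI ballI allI impI)
    show "countable B" by fact
    show "openin euclidean V" if "V \<in> B" for V using topological_basis_open[OF B(2) that] by simp
    show "\<exists>V\<in>B. x \<in> V \<and> V \<subseteq> U" if "openin euclidean U \<and> x \<in> U" for U and x :: 'a
      using topological_basisE[OF B(2), of U x] that by (metis open_openin)
  qed
qed

text \<open>A continuous path is, up to \<open>e\<close>, a step function on a grid of mesh \<open>1 / n\<close> with values in the dense set;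
this is uniform continuity. The finitely many values are kept in a list in order to have only
countably many such step functions.\<close>

lemma small_step_approximation:
  fixes f :: "real \<Rightarrow> 'a::metric_space"
  assumes f: "continuous_on {0..T} f" and e: "0 < e"
    and D: "\<And>X. open X \<Longrightarrow> X \<noteq> {} \<Longrightarrow> \<exists>d\<in>D. d \<in> (X :: 'a set)"
  obtains n :: nat and qs where "qs \<in> lists D" "\<And>t. t \<in> {0..T} \<Longrightarrow> dist (f t) (qs ! nat \<lfloor>t * n\<rfloor>) < e"
proof -
  obtain \<delta> where \<delta>: "0 < \<delta>" "\<And>s t. s \<in> {0..T} \<Longrightarrow> t \<in> {0..T} \<Longrightarrow> dist t s < \<delta> \<Longrightarrow> dist (f t) (f s) < e / 2"
    using compact_uniformly_continuous[OF f] e unfolding uniformly_continuous_on_def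
    by (metis compact_Icc half_gt_zero)
  obtain n :: nat where n: "0 < n" "1 / n < \<delta>"
    using \<delta>(1) by (metis nat_approx_posE zero_less_Suc)
  have "\<exists>d\<in>D. d \<in> ball (f (real j / n)) (e / 2)" for j :: nat
    using D[of "ball (f (real j / n)) (e / 2)"] e by auto
  then obtain d where d: "\<And>j. d j \<in> D" "\<And>j. dist (f (real j / n)) (d j) < e / 2"
    by (metis mem_ball)
  let ?qs = "map d [0..<Suc (nat \<lfloor>T * n\<rfloor>)]"
  show thesis
  proof (rule that[of ?qs n])
    show "?qs \<in> lists D" using d(1) by auto
    fix t assume t: "t \<in> {0..T}"
    define j where "j = nat \<lfloor>t * n\<rfloor>"
    have "0 \<le> t * n" using t by simp
    then have j: "real j \<le> t * n" "t * n < real j + 1"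
      unfolding j_def by (auto simp: of_nat_nat) 
    have "j \<le> nat \<lfloor>T * n\<rfloor>" unfolding j_def using t n by (intro nat_mono floor_mono) auto
    then have q: "?qs ! j = d j" by (simp add: nth_append del: upt_Suc)
    have "real j / n \<le> t * n / n" "t * n / n < (real j + 1) / n"
      using divide_right_mono[OF j(1), of n] divide_strict_right_mono[OF j(2), of n] n(1) by simp_all
    then have s: "real j / n \<le> t" "t - real j / n < 1 / n" "0 \<le> real j / n"
      using n(1) by (auto simp: add_divide_distrib)
    have "dist t (real j / n) < \<delta>" using s n(2) by (simp add: dist_real_def)
    moreover have "real j / n \<in> {0..T}" using s t by auto
    ultimately have "dist (f t) (f (real j / n)) < e / 2" using \<delta>(2) t by blast
    then have "dist (f t) (d j) < e" using dist_triangle[of "f t" "d j" "f (real j / n)"] d(2)[of j] by linarith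
    then show "dist (f t) (?qs ! nat \<lfloor>t * n\<rfloor>) < e" using q j_def by metis
  qed
qed

text \<open>The paths close to a given step function form a set of small diameter, and by the preceding
lemma countably many of these sets cover the space at every scale. Balls around one chosen path from
each of them form a base; this avoids any approximation by continuous functions of a special
form.\<close>

lemma second_countable_path_space:
  "second_countable (path_space T :: (real \<Rightarrow> 'a::{metric_space, second_countable_topology}) topology)"
proof -
  let ?P = "path_space T :: (real \<Rightarrow> 'a) topology"
  interpret Metric_space "paths T :: (real \<Rightarrow> 'a) set" "mdist (path_metric T)"
    by (rule Metric_space_path_space)
  obtain D :: "'a set" where D: "countable D" "\<And>X. open X \<Longrightarrow> X \<noteq> {} \<Longrightarrow> \<exists>d\<in>D. d \<in> X"
    by (rule countable_dense_setE) blast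
  define e where "e m = 1 / real (Suc m)" for m
  have e: "0 < e m" for m by (simp add: e_def)
  define C where "C p = (case p of (m, n, qs) \<Rightarrow>
    {f \<in> paths T. \<forall>t\<in>{0..T}. dist (f t) (qs ! nat \<lfloor>t * real n\<rfloor>) < e m})" for p :: "nat \<times> nat \<times> 'a list"
  define g where "g p = (SOME f. f \<in> C p)" for p
  \<comment> \<open>If \<open>f\<close> lies in \<open>C p\<close>, its distance from \<open>g p\<close> is at most twice \<open>e\<close>, so the ball of radius five times \<open>e\<close> contains \<open>f\<close> and lies in the ball of radius ten times \<open>e\<close> around \<open>f\<close>.\<close>
  let ?B = "(\<lambda>p. mball (g p) (5 * e (fst p))) ` (UNIV \<times> UNIV \<times> lists D)"
  show ?thesis unfolding second_countable_def
  proof (intro exI[of _ ?B] conjI ballI allI impI)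
    show "countable ?B"
      by (intro countable_image countable_SIGMA countable_lists D(1) countableI_type)
    fix V assume "V \<in> ?B"
    then obtain p where "V = mball (g p) (5 * e (fst p))" by blast
    then show "openin ?P V" unfolding path_space_eq[of T] by (simp only: openin_mball)
  next
    fix U f assume Uf: "openin ?P U \<and> f \<in> U"
    then obtain r where r: "0 < r" "mball f r \<subseteq> U"
      using openin_mtopology[of U] unfolding path_space_eq[of T, symmetric] by blast
    obtain m where m: "e m < r / 10" using r(1) nat_approx_posE[of "r / 10"] unfolding e_def by auto
    have f: "f \<in> paths T" using Uf openin_subset[of ?P U] by (auto simp: topspace_path_space)
    then have "continuous_on {0..T} f" by (simp add: topspace_path_space paths_def)
    from small_step_approximation[OF this e[of m] D(2)]
    obtain n qs where qs: "qs \<in> lists D" "\<And>t. t \<in> {0..T} \<Longrightarrow> dist (f t) (qs ! nat \<lfloor>t * real n\<rfloor>) < e m"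
      by metis
    let ?p = "(m, n, qs)"
    have "f \<in> C ?p" using qs(2) f by (simp add: C_def)
    then have gC: "g ?p \<in> C ?p" unfolding g_def by (rule someI[of "\<lambda>f. f \<in> C ?p"])
    then have g: "g ?p \<in> paths T" by (simp add: C_def)
    have "dist (g ?p t) (f t) \<le> 5 * e m / 2" if t: "t \<in> {0..T}" for t
    proof -
      have "dist (g ?p t) (qs ! nat \<lfloor>t * real n\<rfloor>) < e m" using gC t by (simp add: C_def)
      then show ?thesis using qs(2)[OF t] e[of m] dist_triangle2[of "g ?p t" "f t" "qs ! nat \<lfloor>t * real n\<rfloor>"]
        by linarith
    qed
    then have d: "mdist (path_metric T) (g ?p) f < 5 * e m"
      using e[of m] by (intro path_metric_less) auto
    have "f \<in> mball (g ?p) (5 * e m)" using d f g by simp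
    moreover have "mball (g ?p) (5 * e m) \<subseteq> mball f r"
    proof
      fix h assume h: "h \<in> mball (g ?p) (5 * e m)"
      then have "mdist (path_metric T) f h \<le> mdist (path_metric T) (g ?p) f + mdist (path_metric T) (g ?p) h"
        using f g triangle''[of f "g ?p" h] by (auto simp: commute)
      then show "h \<in> mball f r" using h f d m by auto
    qed
    ultimately have "f \<in> mball (g ?p) (5 * e m)" "mball (g ?p) (5 * e m) \<subseteq> U" using r(2) by auto
    moreover have "mball (g ?p) (5 * e m) \<in> ?B" using qs(1) by (intro image_eqI[of _ _ ?p]) auto
    ultimately show "\<exists>V\<in>?B. f \<in> V \<and> V \<subseteq> U" by blast
  qed
qed

text \<open>Together with the measurability of pairs this makes a random continuous path jointly measurable in
the outcome and the time.\<close>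

lemma continuous_map_evaluation:
  "continuous_map (prod_topology (path_space T) (top_of_set {0..T})) euclidean (\<lambda>(f, t). f t :: 'a::metric_space)"
proof -
  have "continuous_map (prod_topology (path_space T) (top_of_set {0..T}))
    (Metric_space.mtopology (mspace euclidean_metric) (mdist euclidean_metric)) (\<lambda>(f, t). f t :: 'a)"
    unfolding Metric_space.continuous_map_to_metric[OF Metric_space_mspace_mdist]
  proof (intro ballI allI impI)
    fix z and e :: real
    assume z: "z \<in> topspace (prod_topology (path_space T :: (real \<Rightarrow> 'a) topology) (top_of_set {0..T}))" and e: "0 < e"
    obtain f0 t0 where z0: "z = (f0, t0)" by force
    have f0: "f0 \<in> paths T" and t0: "t0 \<in> {0..T}" using z by (auto simp: z0 topspace_path_space)
    then have "continuous_on {0..T} f0" by (simp add: topspace_path_space paths_def)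
    then obtain d where d: "0 < d" "\<And>t. t \<in> {0..T} \<Longrightarrow> dist t t0 < d \<Longrightarrow> dist (f0 t) (f0 t0) < e / 2"
      using t0 e unfolding continuous_on_iff by (meson half_gt_zero)
    obtain U where U: "openin (path_space T) U" "f0 \<in> U" 
      "\<And>g t. g \<in> U \<Longrightarrow> t \<in> {0..T} \<Longrightarrow> dist (f0 t) (g t) < e / 2"
      by (rule path_space_neighbourhoodE[OF f0, of "e / 2"]) (use e in simp_all)
    let ?V = "{0..T} \<inter> ball t0 d"
    have "openin (top_of_set {0..T}) ?V" by (simp add: openin_open_Int)
    then have "openin (prod_topology (path_space T) (top_of_set {0..T})) (U \<times> ?V)"
      using U(1) by (simp add: openin_prod_Times_iff)
    moreover have "z \<in> U \<times> ?V" using U(2) t0 d(1) by (simp add: z0)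
    moreover have "dist (f0 t0) (g t) < e" if "g \<in> U" "t \<in> ?V" for g t
    proof -
      have "dist (f0 t) (f0 t0) < e / 2" "dist (f0 t) (g t) < e / 2"
        using that d(2)[of t] U(3)[of g t] by (auto simp: dist_commute)
      then show ?thesis using dist_triangle3[of "f0 t0" "g t" "f0 t"] by linarith
    qed
    ultimately show "\<exists>U. openin (prod_topology (path_space T :: (real \<Rightarrow> 'a) topology) (top_of_set {0..T})) U \<and>
       z \<in> U \<and> (\<forall>y\<in>U. (case y of (f, t) \<Rightarrow> f t) \<in> Metric_space.mball (mspace euclidean_metric) (mdist euclidean_metric)
          (case z of (f, t) \<Rightarrow> f t) e)"
      by (intro exI[of _ "U \<times> ?V"]) (auto simp: z0 Metric_space.in_mball[OF Metric_space_mspace_mdist])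
  qed
  moreover have "Metric_space.mtopology (mspace euclidean_metric) (mdist euclidean_metric) = (euclidean :: 'a topology)"
    using mtopology_of_euclidean[where 'a = 'a] by (simp only: mtopology_of_def)
  ultimately show ?thesis by (simp only:)
qed

lemma norm_mult_vec_le: "norm (u * v) \<le> norm u * norm v" for u v :: "real ^ 'n"
proof -
  have "norm (u * v) \<le> norm (norm u *\<^sub>R v)"
  proof (rule norm_le_componentwise_cart)
    fix i
    have "\<bar>u $ i\<bar> * \<bar>v $ i\<bar> \<le> norm u * \<bar>v $ i\<bar>"
      by (intro mult_right_mono component_le_norm_cart) auto
    then show "norm ((u * v) $ i) \<le> norm ((norm u *\<^sub>R v) $ i)" by (simp add: abs_mult)
  qed
  then show ?thesis by simp
qed

lemma continuous_on_mult_vec: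
  fixes a :: "real ^ 'n" and f :: "real \<Rightarrow> real ^ 'n"
  assumes "continuous_on S f"
  shows "continuous_on S (\<lambda>t. a * f t)"
proof -
  have "continuous_on S (\<lambda>t. \<chi> i. a $ i * f t $ i)" using assms by (intro continuous_intros)
  moreover have "(\<chi> i. a $ i * v $ i) = a * v" for v by (simp add: vec_eq_iff)
  ultimately show ?thesis by simp
qed

definition affine_path :: "real \<Rightarrow> real ^ 'p \<Rightarrow> (real \<Rightarrow> real ^ 'p) \<Rightarrow> (real \<Rightarrow> real ^ 'p) \<Rightarrow> real \<Rightarrow> real ^ 'p" where
  "affine_path T a b x = (\<lambda>t\<in>{0..T}. a * x t + b t)"

lemma affine_path_in_paths:
  assumes "b \<in> paths T" "x \<in> paths T"
  shows "affine_path T a b x \<in> paths T"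
proof -
  have "continuous_on {0..T} (\<lambda>t. a * x t + b t)"
    using assms by (intro continuous_on_add continuous_on_mult_vec) (auto simp: topspace_path_space paths_def)
  then have "continuous_on {0..T} (affine_path T a b x)"
    unfolding affine_path_def by (rule continuous_on_eq) auto
  then show ?thesis by (simp add: topspace_path_space paths_def affine_path_def)
qed

text \<open>Continuity rests on
\<open>a * x + b - (a' * x' + b') = (a - a') * x + a' * (x - x') + (b - b')\<close>, where the path \<open>x\<close> is bounded and
\<open>a'\<close> stays bounded near \<open>a\<close>.\<close>

lemma continuous_map_affine_path:
  "continuous_map (prod_topology (prod_topology nonneg_orthant (path_space T)) (path_space T)) (path_space T)
     (\<lambda>((a, b), x). affine_path T a b x :: real \<Rightarrow> real ^ 'p)"
proof (rule continuous_map_into_path_space)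
  let ?O = "nonneg_orthant :: (real ^ 'p) topology" and ?P = "path_space T :: (real \<Rightarrow> real ^ 'p) topology"
  let ?E = "prod_topology (prod_topology ?O ?P) ?P"
  let ?F = "\<lambda>((a, b), x). affine_path T a b x :: real \<Rightarrow> real ^ 'p"
  show "?F z \<in> paths T" if "z \<in> topspace ?E" for z
    using that by (auto simp: topspace_path_space intro: affine_path_in_paths)
  fix z and e :: real assume z: "z \<in> topspace ?E" and e: "0 < e"
  obtain a b x where zabx: "z = ((a, b), x)" by (cases z) auto
  have a: "a \<in> {a. \<forall>i. 0 \<le> a $ i}" and b: "b \<in> paths T" and x: "x \<in> paths T"
    using z by (auto simp: zabx nonneg_orthant_def topspace_path_space)
  have "compact (x ` {0..T})" using x by (intro compact_continuous_image) (auto simp: topspace_path_space paths_def)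
  then have "bounded (x ` {0..T})" by (rule compact_imp_bounded)
  then obtain R where R: "0 < R" "\<And>t. t \<in> {0..T} \<Longrightarrow> norm (x t) \<le> R"
    unfolding bounded_pos by auto
  define Q where "Q = norm a + 1"
  have Q: "0 < Q" by (simp add: Q_def add_nonneg_pos)
  define d where "d = min 1 (e / (3 * R))"
  have d: "0 < d" "d \<le> 1" "d * R \<le> e / 3" using e R(1) by (auto simp: d_def min_def field_simps)
  obtain V where V: "openin ?P V" "b \<in> V" "\<And>g t. g \<in> V \<Longrightarrow> t \<in> {0..T} \<Longrightarrow> dist (b t) (g t) < e / 3"
    by (rule path_space_neighbourhoodE[OF b, of "e / 3"]) (use e in simp_all)
  obtain W where W: "openin ?P W" "x \<in> W" "\<And>g t. g \<in> W \<Longrightarrow> t \<in> {0..T} \<Longrightarrow> dist (x t) (g t) < e / (3 * Q)"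
    by (rule path_space_neighbourhoodE[OF x, of "e / (3 * Q)"]) (use e Q in simp_all)
  let ?A = "{a. \<forall>i. 0 \<le> a $ i} \<inter> ball a d"
  have "openin ?O ?A" by (simp add: nonneg_orthant_def openin_open_Int)
  then have "openin ?E ((?A \<times> V) \<times> W)" using V(1) W(1) by (simp add: openin_prod_Times_iff)
  moreover have "z \<in> (?A \<times> V) \<times> W" using a d(1) V(2) W(2) by (simp add: zabx)
  moreover have "dist (?F z t) (?F y t) \<le> e" if y: "y \<in> (?A \<times> V) \<times> W" and t: "t \<in> {0..T}" for y t
  proof -
    obtain a' b' x' where y': "y = ((a', b'), x')" by (cases y) auto
    have a': "norm (a - a') < d" and b': "norm (b t - b' t) < e / 3" and x': "norm (x t - x' t) < e / (3 * Q)"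
      using y t V(3)[of b' t] W(3)[of x' t] by (auto simp: y' dist_norm)
    have "norm a' \<le> norm a + norm (a - a')" by (metis norm_minus_commute norm_triangle_sub)
    then have nQ: "norm a' \<le> Q" using a' d(2) by (simp add: Q_def)
    have "(a * x t + b t) - (a' * x' t + b' t) = (a - a') * x t + a' * (x t - x' t) + (b t - b' t)"
      by (simp add: algebra_simps)
    also have "norm \<dots> \<le> norm ((a - a') * x t) + norm (a' * (x t - x' t)) + norm (b t - b' t)"
      by (intro norm_triangle_le add_mono order_refl norm_triangle_ineq)
    also have "\<dots> \<le> norm (a - a') * norm (x t) + norm a' * norm (x t - x' t) + norm (b t - b' t)"
      by (intro add_mono norm_mult_vec_le order_refl)
    also have "\<dots> \<le> d * R + Q * (e / (3 * Q)) + e / 3"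
      using a' b' x' nQ R t d Q e by (intro add_mono mult_mono) auto
    also have "\<dots> \<le> e" using d(3) Q by simp
    finally show ?thesis using t by (simp add: zabx y' affine_path_def dist_norm)
  qed
  ultimately show "\<exists>U. openin ?E U \<and> z \<in> U \<and> (\<forall>y\<in>U. \<forall>t\<in>{0..T}. dist (?F z t) (?F y t) \<le> e)"
    by (intro exI[of _ "(?A \<times> V) \<times> W"] conjI ballI)
qed

section \<open>Gaussian processes and their reproducing kernel Hilbert spaces\<close>

lemma normal_density_le:
  assumes "0 < \<sigma>"
  shows "normal_density 0 \<sigma> x \<le> 1 / \<sigma>"
proof -
  have "\<sigma>\<^sup>2 \<le> 2 * pi * \<sigma>\<^sup>2" using pi_gt3 by (intro mult_le_cancel_right1[THEN iffD2]) auto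
  then have "\<sigma> \<le> sqrt (2 * pi * \<sigma>\<^sup>2)" by (rule real_le_rsqrt)
  then have "1 / sqrt (2 * pi * \<sigma>\<^sup>2) * exp (- (x - 0)\<^sup>2 / (2 * \<sigma>\<^sup>2)) \<le> 1 / \<sigma> * 1"
    using assms by (intro mult_mono divide_left_mono) auto
  then show ?thesis by (simp add: normal_density_def)
qed

text \<open>A normal variable that charges an interval \<open>[-R, R]\<close> substantially has small variance, since its
density is at most \<open>1 / \<sigma>\<close>: from \<open>1 / 2 \<le> 2 * R / \<sigma>\<close> follows \<open>\<sigma> \<le> 4 * R\<close>.\<close>

lemma (in prob_space) normal_second_moment_le:
  assumes \<sigma>: "0 < \<sigma>" and Y: "distributed M lborel Y (\<lambda>x. ennreal (normal_density 0 \<sigma> x))"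
    and R: "0 \<le> R" and half: "1 / 2 \<le> prob {\<omega> \<in> space M. \<bar>Y \<omega>\<bar> \<le> R}"
  shows "(\<integral>\<^sup>+\<omega>. ennreal ((Y \<omega>)\<^sup>2) \<partial>M) \<le> ennreal ((4 * R)\<^sup>2)"
proof -
  have eq: "{\<omega> \<in> space M. \<bar>Y \<omega>\<bar> \<le> R} = Y -` {- R..R} \<inter> space M" by auto
  have "ennreal (1 / 2) \<le> emeasure M (Y -` {- R..R} \<inter> space M)"
    using half unfolding eq emeasure_eq_measure by (simp add: ennreal_leI del: ennreal_half)
  also have "\<dots> = (\<integral>\<^sup>+x. ennreal (normal_density 0 \<sigma> x) * indicator {- R..R} x \<partial>lborel)"
    by (rule distributed_emeasure[OF Y]) simp
  also have "\<dots> \<le> (\<integral>\<^sup>+x. ennreal (1 / \<sigma>) * indicator {- R..R} x \<partial>lborel)"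
    using \<sigma> by (intro nn_integral_mono mult_right_mono ennreal_leI normal_density_le) auto
  also have "\<dots> = ennreal (1 / \<sigma> * (2 * R))"
    using \<sigma> R by (subst nn_integral_cmult_indicator) (auto simp: ennreal_mult[symmetric])
  finally have "1 / 2 \<le> 1 / \<sigma> * (2 * R)" using \<sigma> R by (subst (asm) ennreal_le_iff) auto
  then have le: "\<sigma> \<le> 4 * R" using \<sigma> by (simp add: field_simps)
  have int: "integrable lborel (\<lambda>x. normal_density 0 \<sigma> x * (x - 0) ^ 2)"
    using \<sigma> by (rule integrable_normal_moment)
  have "(\<integral>\<^sup>+\<omega>. ennreal ((Y \<omega>)\<^sup>2) \<partial>M) = (\<integral>\<^sup>+x. ennreal (normal_density 0 \<sigma> x) * ennreal (x\<^sup>2) \<partial>lborel)"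
    by (rule distributed_nn_integral[OF Y, symmetric]) simp
  also have "\<dots> = (\<integral>\<^sup>+x. ennreal (normal_density 0 \<sigma> x * (x - 0) ^ 2) \<partial>lborel)"
    by (intro nn_integral_cong) (simp add: ennreal_mult)
  also have "\<dots> = ennreal (\<integral>x. normal_density 0 \<sigma> x * (x - 0) ^ 2 \<partial>lborel)"
    by (rule nn_integral_eq_integral[OF int]) simp
  also have "(\<integral>x. normal_density 0 \<sigma> x * (x - 0) ^ 2 \<partial>lborel) = \<sigma>\<^sup>2"
    using integral_normal_moment_even[OF \<sigma>, of 0 1] by simp
  also have "ennreal (\<sigma>\<^sup>2) \<le> ennreal ((4 * R)\<^sup>2)"
    using le \<sigma> by (intro ennreal_leI power_mono) auto
  finally show ?thesis .
qed

lemma space_finite_borel_on: "finite_borel_on T \<alpha> \<Longrightarrow> space \<alpha> = {0..T}"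
  unfolding finite_borel_on_def using sets_eq_imp_space_eq[of \<alpha> "restrict_space borel {0..T}"]
  by (simp add: space_restrict_space)

lemma measurable_borel_of_top_of_set:
  assumes "finite_borel_on T \<alpha>"
  shows "(\<lambda>t. t) \<in> measurable \<alpha> (borel_of (top_of_set {0..T}))"
proof (rule measurable_borel_ofI)
  note sp = space_finite_borel_on[OF assms]
  show "t \<in> topspace (top_of_set {0..T})" if "t \<in> space \<alpha>" for t
    using that by (simp add: sp)
  fix \<Theta> assume "openin (top_of_set {0..T}) \<Theta>"
  then obtain S where S: "open S" "\<Theta> = {0..T} \<inter> S" by (auto simp: openin_open)
  have "{t \<in> space \<alpha>. t \<in> \<Theta>} = {0..T} \<inter> S" by (auto simp: sp S)
  also have "\<dots> \<in> sets (restrict_space borel {0..T})"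
    using S(1) by (auto simp: sets_restrict_space)
  finally show "{t \<in> space \<alpha>. t \<in> \<Theta>} \<in> sets \<alpha>" using assms by (simp add: finite_borel_on_def)
qed

lemma closedin_bounded_paths:
  assumes "0 \<le> T"
  shows "closedin (path_space T) {f \<in> topspace (path_space T). \<forall>t\<in>{0..T}. \<bar>f t :: real\<bar> \<le> R}"
proof -
  have "closedin (path_space T) {f \<in> topspace (path_space T). f t \<in> {- R..R}}" if "t \<in> {0..T}" for t
  proof (rule closedin_continuous_map_preimage[where Y = euclidean])
    have "continuous_map (path_space T) (prod_topology (path_space T) (top_of_set {0..T})) (\<lambda>f. (f, t))"
      using that by (simp add: continuous_map_pairedI)
    from continuous_map_compose[OF this continuous_map_evaluation]
    show "continuous_map (path_space T) euclidean (\<lambda>f. f t :: real)" by (simp add: comp_def)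
  qed simp
  then have "closedin (path_space T) (\<Inter>t\<in>{0..T}. {f \<in> topspace (path_space T). f t \<in> {- R..R}})"
    using assms by (intro closedin_Inter) auto
  also have "(\<Inter>t\<in>{0..T}. {f \<in> topspace (path_space T). f t \<in> {- R..R}}) =
    {f \<in> topspace (path_space T). \<forall>t\<in>{0..T}. \<bar>f t\<bar> \<le> R}"
    using assms by (force simp: abs_le_iff)
  finally show ?thesis .
qed

text \<open>A function that is not measurable has integral zero with respect to both measures. Such functions can
occur as \<open>U \<omega>\<close> for \<open>\<omega>\<close> outside the space of the probability measure.\<close>

lemma integral_scale_measure:
  fixes f :: "'a \<Rightarrow> real"
  assumes c: "0 \<le> c"
  shows "(\<integral>x. f x \<partial>scale_measure (ennreal c) M) = c * (\<integral>x. f x \<partial>M)"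
proof (cases "f \<in> borel_measurable M")
  case True
  have "scale_measure (ennreal c) M = density M (\<lambda>_. ennreal c)"
    by (rule measure_eqI) (auto simp: emeasure_density nn_integral_cmult_indicator)
  then show ?thesis using True c by (simp add: integral_density)
next
  case False
  then have "f \<notin> borel_measurable (scale_measure (ennreal c) M)"
    by (simp add: measurable_cong_sets[OF sets_scale_measure refl])
  with False have "\<not> integrable (scale_measure (ennreal c) M) f" "\<not> integrable M f"
    using borel_measurable_integrable by blast+
  then show ?thesis by (simp add: not_integrable_integral_eq)
qed

locale gaussian_process = prob_space M for M :: "'w measure" +
  fixes T :: real and U :: "'w \<Rightarrow> real \<Rightarrow> real"
  assumes T: "0 < T" and process: "continuous_centered_gaussian_process M T U"
begin

lemma U_measurable: "U \<in> measurable M (borel_of (path_space T))"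
  using process by (simp add: continuous_centered_gaussian_process_def)

lemma U_in_paths: "\<omega> \<in> space M \<Longrightarrow> U \<omega> \<in> paths T"
  using measurable_borel_of_topspace[OF U_measurable] by (simp add: topspace_path_space)

lemma gaussian_at:
  assumes "t \<in> {0..T}"
  shows "centered_gaussian M (\<lambda>\<omega>. U \<omega> t)"
  using process[unfolded continuous_centered_gaussian_process_def, THEN conjunct2, THEN conjunct2,
      rule_format, of "{t}" "\<lambda>_. 1"] assms by simp

lemma measurable_at: "t \<in> {0..T} \<Longrightarrow> (\<lambda>\<omega>. U \<omega> t) \<in> borel_measurable M"
  using gaussian_at by (simp add: centered_gaussian_def)

lemma measurable_joint:
  assumes "finite_borel_on T \<alpha>"
  shows "(\<lambda>(\<omega>, t). U \<omega> t) \<in> borel_measurable (M \<Otimes>\<^sub>M \<alpha>)"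
proof -
  have "second_countable (top_of_set {0..T})"
    by (intro second_countable_subtopology second_countable_euclidean)
  moreover have "(\<lambda>p. U (fst p)) \<in> measurable (M \<Otimes>\<^sub>M \<alpha>) (borel_of (path_space T))"
    using measurable_fst U_measurable by (rule measurable_compose)
  moreover have "snd \<in> measurable (M \<Otimes>\<^sub>M \<alpha>) (borel_of (top_of_set {0..T}))"
    using measurable_snd measurable_borel_of_top_of_set[OF assms] by (rule measurable_compose)
  ultimately have "(\<lambda>p. (U (fst p), snd p)) \<in> measurable (M \<Otimes>\<^sub>M \<alpha>)
      (borel_of (prod_topology (path_space T) (top_of_set {0..T})))"
    by (rule measurable_Pair_borel_of)
  from measurable_compose[OF this continuous_map_measurable_borel_of[OF continuous_map_evaluation]]
  have "(\<lambda>p. U (fst p) (snd p)) \<in> measurable (M \<Otimes>\<^sub>M \<alpha>) (borel_of euclidean)" by simp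
  then show ?thesis
    by (simp add: case_prod_beta' measurable_cong_sets[OF refl sets_borel_of_euclidean])
qed

text \<open>Paths are bounded, so for some \<open>n\<close> the whole path stays in \<open>[-n, n]\<close> with probability at least one
half. Every single coordinate then does so too, and the bound for normal variables is uniform in \<open>t\<close>.\<close>

lemma second_moment_bounded:
  "\<exists>C. \<forall>t\<in>{0..T}. (\<integral>\<^sup>+\<omega>. ennreal ((U \<omega> t)\<^sup>2) \<partial>M) \<le> ennreal C"
proof -
  define A where "A n = {\<omega> \<in> space M. U \<omega> \<in> {f \<in> topspace (path_space T). \<forall>t\<in>{0..T}. \<bar>f t\<bar> \<le> real n}}" for n
  have A: "A n \<in> sets M" for n
    unfolding A_def using T
    by (intro measurable_borel_of_Collect[OF U_measurable] closedin_borel_of closedin_bounded_paths) simp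
  have "incseq A" unfolding A_def incseq_def by (auto intro: order_trans)
  moreover have "(\<Union>n. A n) = space M"
  proof
    show "space M \<subseteq> (\<Union>n. A n)"
    proof
      fix \<omega> assume \<omega>: "\<omega> \<in> space M"
      then have "continuous_on {0..T} (U \<omega>)" using U_in_paths by (simp add: paths_def)
      then have "bounded (U \<omega> ` {0..T})" by (intro compact_imp_bounded compact_continuous_image) auto
      then obtain R where R: "\<And>t. t \<in> {0..T} \<Longrightarrow> \<bar>U \<omega> t\<bar> \<le> R" unfolding bounded_iff by force
      obtain n :: nat where "R \<le> real n" using real_arch_simple by blast
      then have "\<omega> \<in> A n"
        unfolding A_def using \<omega> U_in_paths[OF \<omega>] order_trans[OF R] by (simp add: topspace_path_space)
      then show "\<omega> \<in> (\<Union>n. A n)" by blast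
    qed
  qed (auto simp: A_def)
  ultimately have "(\<lambda>n. prob (A n)) \<longlonglongrightarrow> 1"
    using finite_Lim_measure_incseq[of A] A by (auto simp: prob_space)
  then have "\<forall>\<^sub>F n in sequentially. 1 / 2 < prob (A n)" by (rule order_tendstoD) simp
  then obtain n where n: "1 / 2 < prob (A n)" unfolding eventually_sequentially by blast
  show ?thesis
  proof (intro exI[of _ "(4 * real n)\<^sup>2"] ballI)
    fix t assume t: "t \<in> {0..T}"
    from gaussian_at[OF t] consider "AE \<omega> in M. U \<omega> t = 0"
      | \<sigma> where "0 < \<sigma>" "distributed M lborel (\<lambda>\<omega>. U \<omega> t) (\<lambda>x. ennreal (normal_density 0 \<sigma> x))"
      unfolding centered_gaussian_def by blast
    then show "(\<integral>\<^sup>+\<omega>. ennreal ((U \<omega> t)\<^sup>2) \<partial>M) \<le> ennreal ((4 * real n)\<^sup>2)"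
    proof cases
      case 1
      then have "(\<integral>\<^sup>+\<omega>. ennreal ((U \<omega> t)\<^sup>2) \<partial>M) = (\<integral>\<^sup>+\<omega>. 0 \<partial>M)"
        by (intro nn_integral_cong_AE) auto
      then show ?thesis by simp
    next
      case 2
      have "prob (A n) \<le> prob {\<omega> \<in> space M. \<bar>U \<omega> t\<bar> \<le> real n}"
      proof (rule finite_measure_mono)
        show "A n \<subseteq> {\<omega> \<in> space M. \<bar>U \<omega> t\<bar> \<le> real n}" using t by (auto simp: A_def)
        show "{\<omega> \<in> space M. \<bar>U \<omega> t\<bar> \<le> real n} \<in> events"
          using measurable_at[OF t] by measurable
      qed
      then show ?thesis using 2 n by (intro normal_second_moment_le[of \<sigma>]) auto
    qed
  qed
qed

lemma nn_integral_mult_le: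
  assumes [measurable]: "V \<in> borel_measurable M" "W \<in> borel_measurable M"
  shows "(\<integral>\<^sup>+\<omega>. ennreal (norm (V \<omega> * W \<omega>)) \<partial>M) \<le>
    (\<integral>\<^sup>+\<omega>. ennreal ((V \<omega>)\<^sup>2) \<partial>M) + (\<integral>\<^sup>+\<omega>. ennreal ((W \<omega>)\<^sup>2) \<partial>M)"
proof -
  have "norm (v * w) \<le> v\<^sup>2 + w\<^sup>2" for v w :: real
    using sum_squares_bound[of "\<bar>v\<bar>" "\<bar>w\<bar>"] mult_nonneg_nonneg[of "\<bar>v\<bar>" "\<bar>w\<bar>"]
    by (simp add: abs_mult del: zero_le_mult_iff mult_nonneg_nonneg)
  then have "(\<integral>\<^sup>+\<omega>. ennreal (norm (V \<omega> * W \<omega>)) \<partial>M) \<le> (\<integral>\<^sup>+\<omega>. ennreal ((V \<omega>)\<^sup>2) + ennreal ((W \<omega>)\<^sup>2) \<partial>M)"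
    by (intro nn_integral_mono) (simp add: ennreal_plus[symmetric] ennreal_leI del: ennreal_plus)
  also have "\<dots> = (\<integral>\<^sup>+\<omega>. ennreal ((V \<omega>)\<^sup>2) \<partial>M) + (\<integral>\<^sup>+\<omega>. ennreal ((W \<omega>)\<^sup>2) \<partial>M)"
    by (rule nn_integral_add) auto
  finally show ?thesis .
qed

definition square_integrable :: "('w \<Rightarrow> real) \<Rightarrow> bool" where
  "square_integrable Y \<longleftrightarrow> Y \<in> borel_measurable M \<and> integrable M (\<lambda>\<omega>. (Y \<omega>)\<^sup>2)"

lemma square_integrable_nn:
  assumes "square_integrable Y"
  shows "(\<integral>\<^sup>+\<omega>. ennreal ((Y \<omega>)\<^sup>2) \<partial>M) = ennreal (\<integral>\<omega>. (Y \<omega>)\<^sup>2 \<partial>M)"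
  using assms by (intro nn_integral_eq_integral) (auto simp: square_integrable_def)

lemma square_integrableI:
  assumes "Y \<in> borel_measurable M" "(\<integral>\<^sup>+\<omega>. ennreal ((Y \<omega>)\<^sup>2) \<partial>M) < \<infinity>"
  shows "square_integrable Y"
  unfolding square_integrable_def using assms by (auto intro!: integrableI_bounded)

lemma square_integrable_at: "t \<in> {0..T} \<Longrightarrow> square_integrable (\<lambda>\<omega>. U \<omega> t)"
proof (rule square_integrableI)
  assume t: "t \<in> {0..T}"
  then show "(\<lambda>\<omega>. U \<omega> t) \<in> borel_measurable M" by (rule measurable_at)
  obtain C where "(\<integral>\<^sup>+\<omega>. ennreal ((U \<omega> t)\<^sup>2) \<partial>M) \<le> ennreal C"
    using second_moment_bounded t by blast
  then show "(\<integral>\<^sup>+\<omega>. ennreal ((U \<omega> t)\<^sup>2) \<partial>M) < \<infinity>" by (rule le_less_trans) simp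
qed

lemma integrable_mult:
  assumes V: "square_integrable V" and W: "square_integrable W"
  shows "integrable M (\<lambda>\<omega>. V \<omega> * W \<omega>)"
proof (rule integrableI_bounded)
  have m: "V \<in> borel_measurable M" "W \<in> borel_measurable M" using V W by (auto simp: square_integrable_def)
  then show "(\<lambda>\<omega>. V \<omega> * W \<omega>) \<in> borel_measurable M" by simp
  from nn_integral_mult_le[OF m] show "(\<integral>\<^sup>+\<omega>. ennreal (norm (V \<omega> * W \<omega>)) \<partial>M) < \<infinity>"
    unfolding square_integrable_nn[OF V] square_integrable_nn[OF W] by (rule le_less_trans) (simp add: ennreal_plus[symmetric] del: ennreal_plus)
qed

lemma square_integrable_diff:
  assumes V: "square_integrable V" and W: "square_integrable W"
  shows "square_integrable (\<lambda>\<omega>. V \<omega> - W \<omega>)"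
proof -
  have "integrable M (\<lambda>\<omega>. (V \<omega>)\<^sup>2 + (W \<omega>)\<^sup>2 - 2 * (V \<omega> * W \<omega>))"
    using V W integrable_mult[OF V W] by (auto simp: square_integrable_def)
  moreover have "(\<lambda>\<omega>. (V \<omega>)\<^sup>2 + (W \<omega>)\<^sup>2 - 2 * (V \<omega> * W \<omega>)) = (\<lambda>\<omega>. (V \<omega> - W \<omega>)\<^sup>2)"
    by (simp add: power2_diff algebra_simps)
  ultimately show ?thesis using V W by (auto simp: square_integrable_def)
qed

text \<open>The integrand is dominated by means of \<open>|U\<^sub>t W| \<le> U\<^sub>t\<^sup>2 + W\<^sup>2\<close>, whose expectation is bounded in \<open>t\<close>, and
\<open>\<alpha>\<close> is finite.\<close>

lemma Fubini_weak_integral: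
  assumes W: "square_integrable W" and \<alpha>: "finite_borel_on T \<alpha>"
  shows "(\<lambda>\<omega>. \<integral>t. U \<omega> t \<partial>\<alpha>) \<in> borel_measurable M"
    and "integrable M (\<lambda>\<omega>. (\<integral>t. U \<omega> t \<partial>\<alpha>) * W \<omega>)"
    and "(\<integral>\<omega>. (\<integral>t. U \<omega> t \<partial>\<alpha>) * W \<omega> \<partial>M) = (\<integral>t. (\<integral>\<omega>. U \<omega> t * W \<omega> \<partial>M) \<partial>\<alpha>)"
proof -
  interpret \<alpha>: finite_measure \<alpha> using \<alpha> by (simp add: finite_borel_on_def)
  interpret pair_sigma_finite M \<alpha> ..
  have [measurable]: "W \<in> borel_measurable M" using W by (simp add: square_integrable_def)
  note joint = measurable_joint[OF \<alpha>]
  show "(\<lambda>\<omega>. \<integral>t. U \<omega> t \<partial>\<alpha>) \<in> borel_measurable M"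
    using \<alpha>.borel_measurable_lebesgue_integral[of U M] joint by simp
  obtain C where C: "\<And>t. t \<in> {0..T} \<Longrightarrow> (\<integral>\<^sup>+\<omega>. ennreal ((U \<omega> t)\<^sup>2) \<partial>M) \<le> ennreal C"
    using second_moment_bounded by blast
  have int: "integrable (M \<Otimes>\<^sub>M \<alpha>) (\<lambda>(\<omega>, t). U \<omega> t * W \<omega>)"
  proof (rule integrableI_bounded)
    have "(\<lambda>p. (case p of (\<omega>, t) \<Rightarrow> U \<omega> t) * W (fst p)) \<in> borel_measurable (M \<Otimes>\<^sub>M \<alpha>)"
      using joint by (intro borel_measurable_times) auto
    then show m: "(\<lambda>(\<omega>, t). U \<omega> t * W \<omega>) \<in> borel_measurable (M \<Otimes>\<^sub>M \<alpha>)"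
      by (simp add: case_prod_beta')
    have "(\<integral>\<^sup>+p. ennreal (norm (case p of (\<omega>, t) \<Rightarrow> U \<omega> t * W \<omega>)) \<partial>(M \<Otimes>\<^sub>M \<alpha>)) =
      (\<integral>\<^sup>+t. (\<integral>\<^sup>+\<omega>. ennreal (norm (U \<omega> t * W \<omega>)) \<partial>M) \<partial>\<alpha>)"
      using m by (subst nn_integral_snd[symmetric]) (auto simp: case_prod_beta')
    also have "\<dots> \<le> (\<integral>\<^sup>+t. ennreal C + ennreal (\<integral>\<omega>. (W \<omega>)\<^sup>2 \<partial>M) \<partial>\<alpha>)"
    proof (rule nn_integral_mono)
      fix t assume "t \<in> space \<alpha>"
      then have t: "t \<in> {0..T}" using space_finite_borel_on[OF \<alpha>] by simp
      show "(\<integral>\<^sup>+\<omega>. ennreal (norm (U \<omega> t * W \<omega>)) \<partial>M) \<le> ennreal C + ennreal (\<integral>\<omega>. (W \<omega>)\<^sup>2 \<partial>M)"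
        using nn_integral_mult_le[OF measurable_at[OF t], of W] C[OF t]
        unfolding square_integrable_nn[OF W] by (meson \<open>W \<in> borel_measurable M\<close> add_right_mono order_trans)
    qed
    also have "\<dots> < \<infinity>"
      using \<alpha>.emeasure_finite[of "space \<alpha>"] by (simp add: ennreal_mult_eq_top_iff less_top[symmetric])
    finally show "(\<integral>\<^sup>+p. ennreal (norm (case p of (\<omega>, t) \<Rightarrow> U \<omega> t * W \<omega>)) \<partial>(M \<Otimes>\<^sub>M \<alpha>)) < \<infinity>" .
  qed
  show "integrable M (\<lambda>\<omega>. (\<integral>t. U \<omega> t \<partial>\<alpha>) * W \<omega>)"
    using integrable_fst'[OF int] by simp
  show "(\<integral>\<omega>. (\<integral>t. U \<omega> t \<partial>\<alpha>) * W \<omega> \<partial>M) = (\<integral>t. (\<integral>\<omega>. U \<omega> t * W \<omega> \<partial>M) \<partial>\<alpha>)"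
    using Fubini_integral[OF int] by simp
qed

lemma signed_integral_orthogonal:
  assumes W: "square_integrable W" "\<And>t. t \<in> {0..T} \<Longrightarrow> (\<integral>\<omega>. U \<omega> t * W \<omega> \<partial>M) = 0"
    and V: "V \<in> signed_integrals T U"
  shows "V \<in> borel_measurable M" "integrable M (\<lambda>\<omega>. V \<omega> * W \<omega>)" "(\<integral>\<omega>. V \<omega> * W \<omega> \<partial>M) = 0"
proof -
  obtain \<alpha> \<beta> where \<alpha>: "finite_borel_on T \<alpha>" and \<beta>: "finite_borel_on T \<beta>"
    and V_eq: "V = (\<lambda>\<omega>. (\<integral>t. U \<omega> t \<partial>\<alpha>) - (\<integral>t. U \<omega> t \<partial>\<beta>))"
    using V unfolding signed_integrals_def by blast
  have zero: "(\<integral>t. (\<integral>\<omega>. U \<omega> t * W \<omega> \<partial>M) \<partial>\<nu>) = 0" if "finite_borel_on T \<nu>" for \<nu>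
  proof -
    have "(\<integral>t. (\<integral>\<omega>. U \<omega> t * W \<omega> \<partial>M) \<partial>\<nu>) = (\<integral>t. 0 \<partial>\<nu>)"
      using W(2) space_finite_borel_on[OF that] by (intro Bochner_Integration.integral_cong) auto
    then show ?thesis by simp
  qed
  note F\<alpha> = Fubini_weak_integral[OF W(1) \<alpha>] and F\<beta> = Fubini_weak_integral[OF W(1) \<beta>]
  show "V \<in> borel_measurable M" unfolding V_eq using F\<alpha>(1) F\<beta>(1) by simp
  show "integrable M (\<lambda>\<omega>. V \<omega> * W \<omega>)"
    unfolding V_eq left_diff_distrib using F\<alpha>(2) F\<beta>(2) by (rule Bochner_Integration.integrable_diff)
  show "(\<integral>\<omega>. V \<omega> * W \<omega> \<partial>M) = 0"
    unfolding V_eq left_diff_distrib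
    using F\<alpha>(2,3) F\<beta>(2,3) zero[OF \<alpha>] zero[OF \<beta>] by simp
qed

lemma gaussian_space_square_integrable: "Y \<in> gaussian_space M T U \<Longrightarrow> square_integrable Y"
  by (simp add: gaussian_space_def L2_closure_def square_integrable_def)

lemma gaussian_space_approx:
  assumes "Y \<in> gaussian_space M T U" "0 < e"
  obtains V where "V \<in> signed_integrals T U" "(\<integral>\<^sup>+\<omega>. ennreal ((Y \<omega> - V \<omega>)\<^sup>2) \<partial>M) < ennreal e"
  using assms unfolding gaussian_space_def L2_closure_def by blast

text \<open>A substitute for the Cauchy-Schwarz inequality; the factor one quarter allows the terms in \<open>V\<^sup>2\<close>
to be absorbed into the left-hand side later.\<close>

lemma integral_mult_le:
  assumes V: "square_integrable V" and W: "square_integrable W"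
  shows "\<bar>\<integral>\<omega>. V \<omega> * W \<omega> \<partial>M\<bar> \<le> (\<integral>\<omega>. (V \<omega>)\<^sup>2 \<partial>M) / 4 + (\<integral>\<omega>. (W \<omega>)\<^sup>2 \<partial>M)"
proof -
  have le: "\<bar>v * w\<bar> \<le> v\<^sup>2 / 4 + w\<^sup>2" for v w :: real
    using sum_squares_bound[of "\<bar>v\<bar> / 2" "\<bar>w\<bar>"] by (simp add: abs_mult power_divide)
  have "\<bar>\<integral>\<omega>. V \<omega> * W \<omega> \<partial>M\<bar> \<le> (\<integral>\<omega>. (V \<omega>)\<^sup>2 / 4 + (W \<omega>)\<^sup>2 \<partial>M)"
    using integrable_mult[OF V W] V W le
    by (intro order_trans[OF integral_abs_bound] integral_mono) (auto simp: square_integrable_def)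
  also have "\<dots> = (\<integral>\<omega>. (V \<omega>)\<^sup>2 \<partial>M) / 4 + (\<integral>\<omega>. (W \<omega>)\<^sup>2 \<partial>M)"
    using V W by (subst Bochner_Integration.integral_add) (auto simp: square_integrable_def)
  finally show ?thesis .
qed

text \<open>The difference \<open>D\<close> is orthogonal to every \<open>U\<^sub>t\<close>, hence to every integral against a signed measure, hence
to its own approximations by differences of such integrals.\<close>

lemma rkhs_map_inj_AE:
  assumes Y: "Y \<in> gaussian_space M T U" and Y': "Y' \<in> gaussian_space M T U"
    and eq: "rkhs_map M T U Y = rkhs_map M T U Y'"
  shows "AE \<omega> in M. Y \<omega> = Y' \<omega>"
proof -
  note sY = gaussian_space_square_integrable[OF Y] and sY' = gaussian_space_square_integrable[OF Y']
  define D where "D \<omega> = Y \<omega> - Y' \<omega>" for \<omega>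
  have D: "square_integrable D" unfolding D_def using sY sY' by (rule square_integrable_diff)
  have orth: "(\<integral>\<omega>. U \<omega> t * D \<omega> \<partial>M) = 0" if t: "t \<in> {0..T}" for t
  proof -
    have "(\<integral>\<omega>. U \<omega> t * Y \<omega> \<partial>M) = (\<integral>\<omega>. U \<omega> t * Y' \<omega> \<partial>M)"
      using fun_cong[OF eq, of t] t by (simp add: rkhs_map_def)
    moreover have "(\<integral>\<omega>. U \<omega> t * D \<omega> \<partial>M) = (\<integral>\<omega>. U \<omega> t * Y \<omega> \<partial>M) - (\<integral>\<omega>. U \<omega> t * Y' \<omega> \<partial>M)"
      unfolding D_def right_diff_distrib
      by (intro Bochner_Integration.integral_diff integrable_mult square_integrable_at t sY sY')
    ultimately show ?thesis by simp
  qed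
  have small: "(\<integral>\<omega>. (D \<omega>)\<^sup>2 \<partial>M) \<le> 4 * e" if e: "0 < e" for e
  proof -
    obtain V where V: "V \<in> signed_integrals T U" "(\<integral>\<^sup>+\<omega>. ennreal ((Y \<omega> - V \<omega>)\<^sup>2) \<partial>M) < ennreal e"
      by (rule gaussian_space_approx[OF Y e])
    obtain V' where V': "V' \<in> signed_integrals T U" "(\<integral>\<^sup>+\<omega>. ennreal ((Y' \<omega> - V' \<omega>)\<^sup>2) \<partial>M) < ennreal e"
      by (rule gaussian_space_approx[OF Y' e])
    note oV = signed_integral_orthogonal[OF D orth V(1)] and oV' = signed_integral_orthogonal[OF D orth V'(1)]
    define P where "P \<omega> = Y \<omega> - V \<omega>" for \<omega>
    define P' where "P' \<omega> = Y' \<omega> - V' \<omega>" for \<omega>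
    have "(\<lambda>\<omega>. Y \<omega> - V \<omega>) \<in> borel_measurable M" "(\<lambda>\<omega>. Y' \<omega> - V' \<omega>) \<in> borel_measurable M"
      using sY sY' oV(1) oV'(1) by (auto simp: square_integrable_def)
    then have P: "square_integrable P" and P': "square_integrable P'"
      unfolding P_def P'_def using V(2) V'(2)
      by (auto intro!: square_integrableI intro: less_trans[OF _ ennreal_less_top])
    have "ennreal (\<integral>\<omega>. (P \<omega>)\<^sup>2 \<partial>M) < ennreal e" "ennreal (\<integral>\<omega>. (P' \<omega>)\<^sup>2 \<partial>M) < ennreal e"
      using V(2) V'(2) square_integrable_nn[OF P] square_integrable_nn[OF P'] by (simp_all add: P_def P'_def)
    then have Pe: "(\<integral>\<omega>. (P \<omega>)\<^sup>2 \<partial>M) < e" "(\<integral>\<omega>. (P' \<omega>)\<^sup>2 \<partial>M) < e"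
      by (simp_all add: ennreal_less_iff)
    \<comment> \<open>\<open>D = (P - P') + (V - V')\<close>, and \<open>D\<close> is orthogonal to \<open>V - V'\<close>.\<close>
    have "(\<lambda>\<omega>. (D \<omega>)\<^sup>2) = (\<lambda>\<omega>. (D \<omega> * P \<omega> - D \<omega> * P' \<omega>) + (V \<omega> * D \<omega> - V' \<omega> * D \<omega>))"
      by (simp add: D_def P_def P'_def power2_eq_square algebra_simps)
    then have "(\<integral>\<omega>. (D \<omega>)\<^sup>2 \<partial>M) =
      (\<integral>\<omega>. (D \<omega> * P \<omega> - D \<omega> * P' \<omega>) + (V \<omega> * D \<omega> - V' \<omega> * D \<omega>) \<partial>M)" by simp
    also have "\<dots> = (\<integral>\<omega>. D \<omega> * P \<omega> \<partial>M) - (\<integral>\<omega>. D \<omega> * P' \<omega> \<partial>M)"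
      using integrable_mult[OF D P] integrable_mult[OF D P'] oV(2,3) oV'(2,3) by simp
    also have "\<dots> \<le> (\<integral>\<omega>. (D \<omega>)\<^sup>2 \<partial>M) / 2 + 2 * e"
      using integral_mult_le[OF D P] integral_mult_le[OF D P'] Pe by linarith
    finally show ?thesis by linarith
  qed
  have "(\<integral>\<omega>. (D \<omega>)\<^sup>2 \<partial>M) \<le> 0"
  proof (rule field_le_epsilon)
    fix e :: real assume "0 < e"
    then show "(\<integral>\<omega>. (D \<omega>)\<^sup>2 \<partial>M) \<le> 0 + e" using small[of "e / 4"] by simp
  qed
  moreover have "0 \<le> (\<integral>\<omega>. (D \<omega>)\<^sup>2 \<partial>M)" by simp
  ultimately have "(\<integral>\<omega>. (D \<omega>)\<^sup>2 \<partial>M) = 0" by linarith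
  then have "AE \<omega> in M. (D \<omega>)\<^sup>2 = 0"
    using D by (subst (asm) integral_nonneg_eq_0_iff_AE) (auto simp: square_integrable_def)
  then show ?thesis by (simp add: D_def)
qed

text \<open>Frees the norm from the arbitrary choice of a preimage in its definition.\<close>

lemma rkhs_norm2_rkhs_map:
  assumes Y: "Y \<in> gaussian_space M T U"
  shows "rkhs_norm2 M T U (rkhs_map M T U Y) = ennreal (\<integral>\<omega>. (Y \<omega>)\<^sup>2 \<partial>M)"
proof -
  let ?h = "rkhs_map M T U Y"
  define Y' where "Y' = inv_into (gaussian_space M T U) (rkhs_map M T U) ?h"
  have h: "?h \<in> rkhs_map M T U ` gaussian_space M T U" using Y by blast
  have Y': "Y' \<in> gaussian_space M T U" unfolding Y'_def using h by (rule inv_into_into)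
  have "rkhs_map M T U Y' = ?h" unfolding Y'_def using h by (rule f_inv_into_f)
  from rkhs_map_inj_AE[OF Y' Y this] have "AE \<omega> in M. Y' \<omega> * Y' \<omega> = (Y \<omega>)\<^sup>2"
    by eventually_elim (simp add: power2_eq_square)
  then have "(\<integral>\<omega>. Y' \<omega> * Y' \<omega> \<partial>M) = (\<integral>\<omega>. (Y \<omega>)\<^sup>2 \<partial>M)"
    using gaussian_space_square_integrable[OF Y] gaussian_space_square_integrable[OF Y']
    by (intro integral_cong_AE) (auto simp: square_integrable_def)
  then show ?thesis using h by (simp add: rkhs_norm2_def rkhs_def rkhs_inner_def Y'_def)
qed

lemma signed_integrals_scale:
  assumes V: "V \<in> signed_integrals T U" and c: "0 < c"
  shows "(\<lambda>\<omega>. c * V \<omega>) \<in> signed_integrals T U"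
proof -
  obtain \<alpha> \<beta> where \<alpha>: "finite_borel_on T \<alpha>" and \<beta>: "finite_borel_on T \<beta>"
    and V_eq: "V = (\<lambda>\<omega>. (\<integral>t. U \<omega> t \<partial>\<alpha>) - (\<integral>t. U \<omega> t \<partial>\<beta>))"
    using V unfolding signed_integrals_def by blast
  let ?s = "scale_measure (ennreal c)"
  have fin: "finite_borel_on T (?s \<nu>)" if "finite_borel_on T \<nu>" for \<nu>
    using that unfolding finite_borel_on_def
    by (auto intro!: finite_measureI simp: ennreal_mult_eq_top_iff finite_measure.emeasure_finite space_scale_measure)
  have "(\<lambda>\<omega>. c * V \<omega>) = (\<lambda>\<omega>. (\<integral>t. U \<omega> t \<partial>?s \<alpha>) - (\<integral>t. U \<omega> t \<partial>?s \<beta>))"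
    using c by (simp add: V_eq integral_scale_measure right_diff_distrib)
  then show ?thesis unfolding signed_integrals_def using fin[OF \<alpha>] fin[OF \<beta>] by blast
qed

lemma gaussian_space_scale:
  assumes Y: "Y \<in> gaussian_space M T U" and c: "0 < c"
  shows "(\<lambda>\<omega>. c * Y \<omega>) \<in> gaussian_space M T U"
  unfolding gaussian_space_def L2_closure_def
proof (intro CollectI conjI allI impI)
  note sY = gaussian_space_square_integrable[OF Y]
  show "(\<lambda>\<omega>. c * Y \<omega>) \<in> borel_measurable M" "integrable M (\<lambda>\<omega>. (c * Y \<omega>)\<^sup>2)"
    using sY by (auto simp: square_integrable_def power_mult_distrib)
  fix e :: real assume "0 < e"
  then have e: "0 < e / c\<^sup>2" using c by simp
  obtain V where V: "V \<in> signed_integrals T U" "(\<integral>\<^sup>+\<omega>. ennreal ((Y \<omega> - V \<omega>)\<^sup>2) \<partial>M) < ennreal (e / c\<^sup>2)"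
    by (rule gaussian_space_approx[OF Y e])
  have "square_integrable (\<lambda>_. 0)" by (simp add: square_integrable_def)
  from signed_integral_orthogonal(1)[OF this _ V(1)] have [measurable]: "V \<in> borel_measurable M" by simp
  have [measurable]: "Y \<in> borel_measurable M" using sY by (simp add: square_integrable_def)
  have "(\<integral>\<^sup>+\<omega>. ennreal ((c * Y \<omega> - c * V \<omega>)\<^sup>2) \<partial>M) = (\<integral>\<^sup>+\<omega>. ennreal (c\<^sup>2) * ennreal ((Y \<omega> - V \<omega>)\<^sup>2) \<partial>M)"
    by (intro nn_integral_cong) (simp add: ennreal_mult[symmetric] power_mult_distrib[symmetric] right_diff_distrib)
  also have "\<dots> = ennreal (c\<^sup>2) * (\<integral>\<^sup>+\<omega>. ennreal ((Y \<omega> - V \<omega>)\<^sup>2) \<partial>M)"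
    by (rule nn_integral_cmult) simp
  also have "\<dots> < ennreal (c\<^sup>2) * ennreal (e / c\<^sup>2)"
    using V(2) c by (intro ennreal_mult_strict_left_mono) auto
  also have "\<dots> = ennreal e" using c \<open>0 < e\<close> by (simp add: ennreal_mult[symmetric])
  finally show "\<exists>V\<in>signed_integrals T U. (\<integral>\<^sup>+\<omega>. ennreal ((c * Y \<omega> - V \<omega>)\<^sup>2) \<partial>M) < ennreal e"
    by (intro bexI[of _ "\<lambda>\<omega>. c * V \<omega>"] signed_integrals_scale[OF V(1) c])
qed

lemma rkhs_map_scale: "rkhs_map M T U (\<lambda>\<omega>. c * Y \<omega>) = (\<lambda>t\<in>{0..T}. c * rkhs_map M T U Y t)"
proof (rule ext)
  have "(\<integral>\<omega>. U \<omega> t * (c * Y \<omega>) \<partial>M) = c * (\<integral>\<omega>. U \<omega> t * Y \<omega> \<partial>M)" for t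
    by (subst integral_mult_right_zero[symmetric]) (simp add: mult.left_commute)
  then show "rkhs_map M T U (\<lambda>\<omega>. c * Y \<omega>) t = (\<lambda>t\<in>{0..T}. c * rkhs_map M T U Y t) t" for t
    by (simp add: rkhs_map_def)
qed

lemma rkhs_scale:
  assumes "h \<in> rkhs M T U" "0 < c"
  shows "(\<lambda>t\<in>{0..T}. c * h t) \<in> rkhs M T U"
    and "rkhs_norm2 M T U (\<lambda>t\<in>{0..T}. c * h t) = ennreal (c\<^sup>2) * rkhs_norm2 M T U h"
proof -
  obtain Y where Y: "Y \<in> gaussian_space M T U" "h = rkhs_map M T U Y"
    using assms(1) by (auto simp: rkhs_def)
  have cY: "(\<lambda>\<omega>. c * Y \<omega>) \<in> gaussian_space M T U" using Y(1) assms(2) by (rule gaussian_space_scale)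
  have eq: "(\<lambda>t\<in>{0..T}. c * h t) = rkhs_map M T U (\<lambda>\<omega>. c * Y \<omega>)"
    unfolding Y(2) by (rule rkhs_map_scale[symmetric])
  show "(\<lambda>t\<in>{0..T}. c * h t) \<in> rkhs M T U" unfolding eq rkhs_def using cY by (rule imageI)
  show "rkhs_norm2 M T U (\<lambda>t\<in>{0..T}. c * h t) = ennreal (c\<^sup>2) * rkhs_norm2 M T U h"
    unfolding eq rkhs_norm2_rkhs_map[OF cY] unfolding Y(2) rkhs_norm2_rkhs_map[OF Y(1)]
    by (simp add: power_mult_distrib ennreal_mult)
qed

lemma rkhs_norm2_scale:
  assumes h: "h \<in> extensional {0..T}" and c: "0 < c"
  shows "rkhs_norm2 M T U (\<lambda>t\<in>{0..T}. c * h t) = ennreal (c\<^sup>2) * rkhs_norm2 M T U h"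
proof (cases "h \<in> rkhs M T U")
  case True
  then show ?thesis using c by (rule rkhs_scale)
next
  case False
  have "(\<lambda>t\<in>{0..T}. c * h t) \<notin> rkhs M T U"
  proof
    assume "(\<lambda>t\<in>{0..T}. c * h t) \<in> rkhs M T U"
    then have "(\<lambda>t\<in>{0..T}. 1 / c * (\<lambda>t\<in>{0..T}. c * h t) t) \<in> rkhs M T U"
      by (rule rkhs_scale) (use c in simp)
    also have "(\<lambda>t\<in>{0..T}. 1 / c * (\<lambda>t\<in>{0..T}. c * h t) t) = h"
      using c h by (intro extensionalityI[of _ "{0..T}"]) auto
    finally show False using False by simp
  qed
  then show ?thesis using False c by (simp add: rkhs_norm2_def ennreal_mult_top)
qed

lemma rkhs_norm2_zero: "rkhs_norm2 M T U (\<lambda>t\<in>{0..T}. 0) = 0"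
proof -
  have "finite_borel_on T (null_measure (restrict_space borel {0..T}))"
    unfolding finite_borel_on_def by (auto intro!: finite_measureI)
  then have "(\<lambda>\<omega>. 0) \<in> signed_integrals T U" unfolding signed_integrals_def by force
  then have "(\<lambda>\<omega>. 0) \<in> gaussian_space M T U"
    unfolding gaussian_space_def L2_closure_def by (auto intro!: bexI[of _ "\<lambda>\<omega>. 0"])
  from rkhs_norm2_rkhs_map[OF this] show ?thesis by (simp add: rkhs_map_def)
qed

lemma gaussian_rate_eq: "gaussian_rate M T U h = ennreal (1 / 2) * rkhs_norm2 M T U h"
  by (simp add: gaussian_rate_def rkhs_norm2_def ennreal_mult_top)

end

section \<open>The rate function of the randomly scaled and shifted process\<close>

text \<open>The summand for a positive coefficient: the factor \<open>1 / (2 * a\<^sup>2)\<close> cancels the \<open>a\<^sup>2\<close> from the homogeneity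
of the squared norm.\<close>

lemma (in gaussian_process) cond_rate_translate:
  assumes x: "x \<in> extensional {0..T}" and a: "0 < a" and z: "\<And>t. t \<in> {0..T} \<Longrightarrow> z t = a * x t + b t"
  shows "cond_rate M T U z a b = gaussian_rate M T U x"
proof -
  have "(\<lambda>t\<in>{0..T}. z t - b t) = (\<lambda>t\<in>{0..T}. a * x t)"
    using z by (intro restrict_ext) simp
  then have "cond_rate M T U z a b = ennreal (1 / (2 * a\<^sup>2)) * (ennreal (a\<^sup>2) * rkhs_norm2 M T U x)"
    using a by (simp add: cond_rate_def rkhs_norm2_scale[OF x a])
  also have "\<dots> = ennreal (1 / (2 * a\<^sup>2) * a\<^sup>2) * rkhs_norm2 M T U x"
    by (subst ennreal_mult) (simp_all add: mult.assoc)
  also have "1 / (2 * a\<^sup>2) * a\<^sup>2 = 1 / 2" using a by simp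
  finally show ?thesis by (simp add: gaussian_rate_eq)
qed

lemma (in gaussian_process) gaussian_rate_zero: "gaussian_rate M T U (\<lambda>t\<in>{0..T}. 0) = 0"
  by (simp only: gaussian_rate_eq rkhs_norm2_zero mult_zero_right)

text \<open>Independence of the two sequences enters only through the terms with the same index.\<close>

lemma independent_rv_components:
  assumes M: "prob_space M" and ind: "independent_rv M (Pi\<^sub>M UNIV (\<lambda>_. E)) V (Pi\<^sub>M UNIV (\<lambda>_. F)) W"
    and S: "S \<in> sets E" and S': "S' \<in> sets F"
  shows "measure M {\<omega> \<in> space M. V \<omega> n \<in> S \<and> W \<omega> n \<in> S'} =
    measure M {\<omega> \<in> space M. V \<omega> n \<in> S} * measure M {\<omega> \<in> space M. W \<omega> n \<in> S'}"
proof -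
  interpret prob_space M by fact
  have V: "V \<in> measurable M (Pi\<^sub>M UNIV (\<lambda>_. E))" and W: "W \<in> measurable M (Pi\<^sub>M UNIV (\<lambda>_. F))"
    and indep: "indep_set {V -` S \<inter> space M | S. S \<in> sets (Pi\<^sub>M UNIV (\<lambda>_. E))}
      {W -` S \<inter> space M | S. S \<in> sets (Pi\<^sub>M UNIV (\<lambda>_. F))}"
    using ind by (auto simp: independent_rv_def)
  let ?C = "(\<lambda>f. f n) -` S \<inter> space (Pi\<^sub>M UNIV (\<lambda>_. E))"
  let ?D = "(\<lambda>f. f n) -` S' \<inter> space (Pi\<^sub>M UNIV (\<lambda>_. F))"
  have C: "?C \<in> sets (Pi\<^sub>M UNIV (\<lambda>_. E))" and D: "?D \<in> sets (Pi\<^sub>M UNIV (\<lambda>_. F))"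
    using S S' by (auto intro!: measurable_sets[OF measurable_component_singleton])
  have eqC: "{\<omega> \<in> space M. V \<omega> n \<in> S} = V -` ?C \<inter> space M"
    using measurable_space[OF V] by auto
  have eqD: "{\<omega> \<in> space M. W \<omega> n \<in> S'} = W -` ?D \<inter> space M"
    using measurable_space[OF W] by auto
  have "{\<omega> \<in> space M. V \<omega> n \<in> S \<and> W \<omega> n \<in> S'} = {\<omega> \<in> space M. V \<omega> n \<in> S} \<inter> {\<omega> \<in> space M. W \<omega> n \<in> S'}"
    by auto
  moreover have "{\<omega> \<in> space M. V \<omega> n \<in> S} \<in> {V -` S \<inter> space M | S. S \<in> sets (Pi\<^sub>M UNIV (\<lambda>_. E))}"
    unfolding eqC using C by blast
  moreover have "{\<omega> \<in> space M. W \<omega> n \<in> S'} \<in> {W -` S \<inter> space M | S. S \<in> sets (Pi\<^sub>M UNIV (\<lambda>_. F))}"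
    unfolding eqD using D by blast
  ultimately show ?thesis using indep_setD[OF indep] by simp
qed

locale gaussian_components =
  fixes T :: real and N :: "'p::finite \<Rightarrow> 'v measure" and U :: "'p \<Rightarrow> 'v \<Rightarrow> real \<Rightarrow> real"
  assumes component: "\<And>i. gaussian_process (N i) T (U i)"
begin

definition path_rate :: "(real \<Rightarrow> real ^ 'p) \<Rightarrow> ennreal" where
  "path_rate x = (\<Sum>i\<in>UNIV. gaussian_rate (N i) T (U i) (coord T i x))"

definition total_cond_rate :: "(real \<Rightarrow> real ^ 'p) \<Rightarrow> real ^ 'p \<Rightarrow> (real \<Rightarrow> real ^ 'p) \<Rightarrow> ennreal" where
  "total_cond_rate z a b = (\<Sum>i\<in>UNIV. cond_rate (N i) T (U i) (coord T i z) (a $ i) (coord T i b))"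

lemma total_cond_rate_le:
  assumes a: "\<And>i. 0 \<le> a $ i"
  shows "total_cond_rate (affine_path T a b x) a b \<le> path_rate x"
  unfolding total_cond_rate_def path_rate_def
proof (rule sum_mono)
  fix i
  interpret gaussian_process "N i" T "U i" by (rule component)
  let ?z = "coord T i (affine_path T a b x)"
  have z: "?z t = a $ i * coord T i x t + coord T i b t" if "t \<in> {0..T}" for t
    using that by (simp add: coord_def affine_path_def)
  show "cond_rate (N i) T (U i) ?z (a $ i) (coord T i b) \<le> gaussian_rate (N i) T (U i) (coord T i x)"
  proof (cases "0 < a $ i")
    case True
    have "coord T i x \<in> extensional {0..T}" by (simp add: coord_def)
    from cond_rate_translate[OF this True, of ?z "coord T i b"] z show ?thesis by simp
  next
    case False
    then have "a $ i = 0" using a[of i] by simp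
    then show ?thesis using z by (simp add: cond_rate_def)
  qed
qed

text \<open>Finiteness forces \<open>z\<^sub>i = b\<^sub>i\<close> wherever \<open>a\<^sub>i = 0\<close>, so that the path which vanishes there and equals
\<open>(z\<^sub>i - b\<^sub>i) / a\<^sub>i\<close> elsewhere is mapped to \<open>z\<close>.\<close>

lemma total_cond_rate_attained:
  assumes a: "\<And>i. 0 \<le> a $ i" and b: "b \<in> paths T" and z: "z \<in> paths T"
    and fin: "total_cond_rate z a b < \<infinity>"
  obtains x where "x \<in> paths T" "affine_path T a b x = z" "path_rate x = total_cond_rate z a b"
proof -
  have cz: "z t $ i = b t $ i" if "a $ i = 0" "t \<in> {0..T}" for i t
  proof -
    have "cond_rate (N i) T (U i) (coord T i z) (a $ i) (coord T i b) \<le> total_cond_rate z a b"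
      unfolding total_cond_rate_def by (rule member_le_sum) auto
    then have "cond_rate (N i) T (U i) (coord T i z) (a $ i) (coord T i b) \<noteq> \<infinity>" using fin by auto
    then have "\<forall>t\<in>{0..T}. coord T i z t - coord T i b t = 0"
      using that(1) by (auto simp: cond_rate_def split: if_splits)
    then show ?thesis using that(2) by (simp add: coord_def)
  qed
  define x where "x = (\<lambda>t\<in>{0..T}. \<chi> i. if a $ i = 0 then 0 else (z t $ i - b t $ i) / a $ i)"
  have "continuous_on {0..T} (\<lambda>t. \<chi> i. if a $ i = 0 then 0 else (z t $ i - b t $ i) / a $ i)"
  proof (rule continuous_on_vec_lambda)
    fix i
    have "continuous_on {0..T} (\<lambda>t. z t $ i)" "continuous_on {0..T} (\<lambda>t. b t $ i)"
      using z b by (auto simp: paths_def intro: continuous_on_component)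
    then show "continuous_on {0..T} (\<lambda>t. if a $ i = 0 then 0 else (z t $ i - b t $ i) / a $ i)"
      by (cases "a $ i = 0") (auto intro!: continuous_intros)
  qed
  then have "continuous_on {0..T} x"
    unfolding x_def by (rule continuous_on_eq) simp
  then have xp: "x \<in> paths T" by (simp add: paths_def x_def)
  have ax: "a * x t + b t = z t" if "t \<in> {0..T}" for t
    using that cz by (auto simp: vec_eq_iff x_def)
  have aff: "affine_path T a b x = z"
  proof (rule extensionalityI)
    show "affine_path T a b x \<in> extensional {0..T}" by (simp add: affine_path_def)
    show "z \<in> extensional {0..T}" using z by (simp add: paths_def)
    show "affine_path T a b x t = z t" if "t \<in> {0..T}" for t
      using that ax[OF that] by (simp add: affine_path_def)
  qed
  have "path_rate x = total_cond_rate z a b"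
    unfolding total_cond_rate_def path_rate_def
  proof (rule sum.cong[OF refl])
    fix i
    interpret gaussian_process "N i" T "U i" by (rule component)
    show "gaussian_rate (N i) T (U i) (coord T i x) = cond_rate (N i) T (U i) (coord T i z) (a $ i) (coord T i b)"
    proof (cases "a $ i = 0")
      case True
      have "coord T i x = (\<lambda>t\<in>{0..T}. 0)" unfolding coord_def by (rule restrict_ext) (simp add: x_def True)
      then have "gaussian_rate (N i) T (U i) (coord T i x) = 0" using gaussian_rate_zero by simp
      moreover have "cond_rate (N i) T (U i) (coord T i z) (a $ i) (coord T i b) = 0"
        using cz[OF True] True by (simp add: cond_rate_def coord_def)
      ultimately show ?thesis by simp
    next
      case False
      then have pos: "0 < a $ i" using a[of i] by simp
      have "coord T i x \<in> extensional {0..T}" by (simp add: coord_def)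
      moreover have "coord T i z t = a $ i * coord T i x t + coord T i b t" if "t \<in> {0..T}" for t
        using that ax[OF that, symmetric] by (simp add: coord_def)
      ultimately show ?thesis using cond_rate_translate[OF _ pos, of "coord T i x" "coord T i z" "coord T i b"] by simp
    qed
  qed
  with xp aff show thesis by (rule that)
qed

lemma contraction_joint:
  assumes X_good: "good_rate_function (path_space T) path_rate"
    and AB_good: "good_rate_function (prod_topology nonneg_orthant (path_space T)) I\<^sub>A\<^sub>B"
  shows "rate_contraction (prod_topology (prod_topology nonneg_orthant (path_space T)) (path_space T))
      (prod_topology (prod_topology nonneg_orthant (path_space T)) (path_space T))
      (\<lambda>((a, b), x). ((a, b), affine_path T a b x)) (\<lambda>(ab, x). I\<^sub>A\<^sub>B ab + path_rate x)
      (\<lambda>((a, b), z). I\<^sub>A\<^sub>B (a, b) + total_cond_rate z a b)"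
proof
  let ?P = "path_space T :: (real \<Rightarrow> real ^ 'p) topology"
  let ?E = "prod_topology (nonneg_orthant :: (real ^ 'p) topology) ?P"
  have eq: "(\<lambda>((a, b), x). ((a, b), affine_path T a b x)) =
    (\<lambda>p. (fst p, (\<lambda>((a, b), x). affine_path T a b x :: real \<Rightarrow> real ^ 'p) p))"
    by (auto simp: fun_eq_iff)
  show "continuous_map (prod_topology ?E ?P) (prod_topology ?E ?P)
    (\<lambda>((a, b), x). ((a, b), affine_path T a b x))"
    unfolding eq by (intro continuous_map_pairedI continuous_map_fst continuous_map_affine_path)
  have "metrizable_space (nonneg_orthant :: (real ^ 'p) topology)"
    unfolding nonneg_orthant_def by (intro metrizable_space_subtopology metrizable_space_euclidean)
  then show "Hausdorff_space (prod_topology ?E ?P)"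
    by (intro metrizable_imp_Hausdorff_space) (simp add: metrizable_space_prod_topology metrizable_path_space)
  show "good_rate_function (prod_topology ?E ?P) (\<lambda>(ab, x). I\<^sub>A\<^sub>B ab + path_rate x)"
    using AB_good X_good by (rule good_rate_function_sum)
  fix y assume y: "y \<in> topspace (prod_topology ?E ?P)"
  obtain a b z where abz: "y = ((a, b), z)" by (cases y) auto
  have a: "\<And>i. 0 \<le> a $ i" and b: "b \<in> paths T" and z: "z \<in> paths T"
    using y by (auto simp: abz nonneg_orthant_def topspace_path_space)
  let ?S = "{p \<in> topspace (prod_topology ?E ?P). (\<lambda>((a, b), x). ((a, b), affine_path T a b x)) p = y}"
  have "I\<^sub>A\<^sub>B (a, b) + total_cond_rate z a b = (INF p\<in>?S. (\<lambda>(ab, x). I\<^sub>A\<^sub>B ab + path_rate x) p)"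
  proof (rule antisym)
    show "I\<^sub>A\<^sub>B (a, b) + total_cond_rate z a b \<le> (INF p\<in>?S. (\<lambda>(ab, x). I\<^sub>A\<^sub>B ab + path_rate x) p)"
    proof (rule INF_greatest)
      fix p assume "p \<in> ?S"
      then obtain x where p: "p = ((a, b), x)" and "affine_path T a b x = z"
        by (cases p) (auto simp: abz)
      then have "total_cond_rate z a b \<le> path_rate x" using total_cond_rate_le[OF a] by blast
      then show "I\<^sub>A\<^sub>B (a, b) + total_cond_rate z a b \<le> (\<lambda>(ab, x). I\<^sub>A\<^sub>B ab + path_rate x) p"
        by (simp add: p add_left_mono)
    qed
    show "(INF p\<in>?S. (\<lambda>(ab, x). I\<^sub>A\<^sub>B ab + path_rate x) p) \<le> I\<^sub>A\<^sub>B (a, b) + total_cond_rate z a b"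
    proof (cases "total_cond_rate z a b < \<infinity>")
      case True
      obtain x where x: "x \<in> paths T" "affine_path T a b x = z" "path_rate x = total_cond_rate z a b"
        by (rule total_cond_rate_attained[OF a b z True])
      have "((a, b), x) \<in> ?S" using y x(1,2) by (auto simp: abz topspace_path_space)
      then have "(INF p\<in>?S. (\<lambda>(ab, x). I\<^sub>A\<^sub>B ab + path_rate x) p) \<le> (\<lambda>(ab, x). I\<^sub>A\<^sub>B ab + path_rate x) ((a, b), x)"
        by (rule INF_lower)
      then show ?thesis by (simp add: x(3))
    next
      case False
      then have "total_cond_rate z a b = \<infinity>" by (simp add: less_top[symmetric])
      then show ?thesis by simp
    qed
  qed
  then show "(case y of (ab, z) \<Rightarrow> (case ab of (a, b) \<Rightarrow> \<lambda>z. I\<^sub>A\<^sub>B (a, b) + total_cond_rate z a b) z) =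
    (INF p\<in>?S. (\<lambda>(ab, x). I\<^sub>A\<^sub>B ab + path_rate x) p)"
    by (simp add: abz)
qed

end

lemma contraction_snd:
  assumes F: "Hausdorff_space F" and I: "good_rate_function (prod_topology E F) I"
  shows "rate_contraction (prod_topology E F) F snd I (\<lambda>y. INF x\<in>topspace E. I (x, y))"
proof
  show "continuous_map (prod_topology E F) F snd" by (rule continuous_map_snd)
  show "Hausdorff_space F" by (rule F)
  show "good_rate_function (prod_topology E F) I" by (rule I)
  fix y assume "y \<in> topspace F"
  then have "{p \<in> topspace (prod_topology E F). snd p = y} = (\<lambda>x. (x, y)) ` topspace E" by auto
  then show "(INF x\<in>topspace E. I (x, y)) = (INF p\<in>{p \<in> topspace (prod_topology E F). snd p = y}. I p)"
    by (simp add: image_image)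
qed

theorem theorem3p2:
  fixes T :: real
    and M :: "'w measure"
    and X :: "nat \<Rightarrow> 'w \<Rightarrow> real \<Rightarrow> real ^ 'p"
    and A :: "nat \<Rightarrow> 'w \<Rightarrow> real ^ 'p"
    and B :: "nat \<Rightarrow> 'w \<Rightarrow> real \<Rightarrow> real ^ 'p"
    and Z :: "nat \<Rightarrow> 'w \<Rightarrow> real \<Rightarrow> real ^ 'p"
    and \<gamma> :: "nat \<Rightarrow> real"
    and k :: "'p \<Rightarrow> real \<Rightarrow> real \<Rightarrow> real"
    and N :: "'p \<Rightarrow> 'v measure"
    and U :: "'p \<Rightarrow> 'v \<Rightarrow> real \<Rightarrow> real"
    and I\<^sub>X :: "(real \<Rightarrow> real ^ 'p) \<Rightarrow> ennreal"
    and I\<^sub>A\<^sub>B :: "(real ^ 'p) \<times> (real \<Rightarrow> real ^ 'p) \<Rightarrow> ennreal"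
    and J :: "'p \<Rightarrow> (real \<Rightarrow> real) \<Rightarrow> real \<Rightarrow> (real \<Rightarrow> real) \<Rightarrow> ennreal"
  assumes T: "0 < T"
    and M: "prob_space M"
    and covariance: "\<And>i. continuous_centered_gaussian_process (N i) T (U i)"
      "\<And>i. has_covariance (N i) T (U i) (k i)"
    and I\<^sub>X: "I\<^sub>X = (\<lambda>h. \<Sum>i\<in>UNIV. gaussian_rate (N i) T (U i) (coord T i h))"
    and X_gaussian: "\<And>n. continuous_centered_gaussian_process M T (X n)"
    and X_zero: "\<And>n. AE \<omega> in M. X n \<omega> 0 = 0"
    and X_indep_components: "\<And>n. prob_space.indep_vars M (\<lambda>i. borel_of (path_space T))
      (\<lambda>i \<omega>. coord T i (X n \<omega>)) UNIV"
    and X_LDP: "random_LDP M (path_space T) X \<gamma> I\<^sub>X"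
    and X_good: "good_rate_function (path_space T) I\<^sub>X"
    and AB_LDP: "random_LDP M (prod_topology nonneg_orthant (path_space T))
      (\<lambda>n \<omega>. (A n \<omega>, B n \<omega>)) \<gamma> I\<^sub>A\<^sub>B"
    and AB_good: "good_rate_function (prod_topology nonneg_orthant (path_space T)) I\<^sub>A\<^sub>B"
    and indep: "independent_rv M
      (\<Pi>\<^sub>M n\<in>UNIV. borel_of (prod_topology nonneg_orthant (path_space T))) (\<lambda>\<omega> n. (A n \<omega>, B n \<omega>))
      (\<Pi>\<^sub>M n\<in>UNIV. borel_of (path_space T)) (\<lambda>\<omega> n. X n \<omega>)"
    and Z: "Z = (\<lambda>n \<omega>. \<lambda>t\<in>{0..T}. A n \<omega> \<odot> X n \<omega> t + B n \<omega> t)"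
    and J: "J = (\<lambda>i. cond_rate (N i) T (U i))"
  shows "random_LDP M
      (prod_topology (prod_topology nonneg_orthant (path_space T)) (path_space T))
      (\<lambda>n \<omega>. ((A n \<omega>, B n \<omega>), Z n \<omega>)) \<gamma>
      (\<lambda>((a, b), z). I\<^sub>A\<^sub>B (a, b) + (\<Sum>i\<in>UNIV. J i (coord T i z) (a $ i) (coord T i b)))
    \<and> random_LDP M (path_space T) Z \<gamma>
      (\<lambda>z. INF (a, b) \<in> topspace (prod_topology nonneg_orthant (path_space T)).
         I\<^sub>A\<^sub>B (a, b) + (\<Sum>i\<in>UNIV. J i (coord T i z) (a $ i) (coord T i b)))
    \<and> good_rate_function (path_space T)
      (\<lambda>z. INF (a, b) \<in> topspace (prod_topology nonneg_orthant (path_space T)).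
         I\<^sub>A\<^sub>B (a, b) + (\<Sum>i\<in>UNIV. J i (coord T i z) (a $ i) (coord T i b)))"
proof -
  let ?P = "path_space T :: (real \<Rightarrow> real ^ 'p) topology"
  let ?E = "prod_topology (nonneg_orthant :: (real ^ 'p) topology) ?P"
  interpret gaussian_components T N U
  proof (rule gaussian_components.intro)
    fix i
    show "gaussian_process (N i) T (U i)"
      using covariance(1)[of i] T
      by (auto simp: gaussian_process_def gaussian_process_axioms_def continuous_centered_gaussian_process_def)
  qed
  have path_rate: "I\<^sub>X = path_rate" unfolding I\<^sub>X path_rate_def ..
  have Z_affine: "Z n \<omega> = affine_path T (A n \<omega>) (B n \<omega>) (X n \<omega>)" for n \<omega>
    unfolding Z affine_path_def ..
  have metrizable: "metrizable_space ?P" "metrizable_space ?E"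
    by (simp_all add: metrizable_space_prod_topology metrizable_path_space nonneg_orthant_def
        metrizable_space_subtopology metrizable_space_euclidean)
  have ABX: "random_LDP M (prod_topology ?E ?P) (\<lambda>n \<omega>. ((A n \<omega>, B n \<omega>), X n \<omega>)) \<gamma>
    (\<lambda>(ab, x). I\<^sub>A\<^sub>B ab + path_rate x)"
    using X_LDP X_good unfolding path_rate
    by (intro product_LDP M metrizable_imp_regular_space metrizable second_countable_path_space
        AB_LDP AB_good independent_rv_components[OF M indep, of _ _ for n])
  interpret joint: rate_contraction "prod_topology ?E ?P" "prod_topology ?E ?P"
    "\<lambda>((a, b), x). ((a, b), affine_path T a b x)" "\<lambda>(ab, x). I\<^sub>A\<^sub>B ab + path_rate x"
    "\<lambda>((a, b), z). I\<^sub>A\<^sub>B (a, b) + total_cond_rate z a b"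
    using X_good AB_good unfolding path_rate by (rule contraction_joint)
  have ABZ: "random_LDP M (prod_topology ?E ?P) (\<lambda>n \<omega>. ((A n \<omega>, B n \<omega>), Z n \<omega>)) \<gamma>
    (\<lambda>((a, b), z). I\<^sub>A\<^sub>B (a, b) + total_cond_rate z a b)"
    using joint.contraction_LDP[OF M ABX] by (simp add: Z_affine)
  interpret marginal: rate_contraction "prod_topology ?E ?P" ?P snd
    "\<lambda>((a, b), z). I\<^sub>A\<^sub>B (a, b) + total_cond_rate z a b"
    "\<lambda>z. INF ab\<in>topspace ?E. (\<lambda>((a, b), z). I\<^sub>A\<^sub>B (a, b) + total_cond_rate z a b) (ab, z)"
    by (intro contraction_snd metrizable_imp_Hausdorff_space metrizable joint.contraction_good)
  have rate_eq: "(INF ab\<in>topspace ?E. (\<lambda>((a, b), z). I\<^sub>A\<^sub>B (a, b) + total_cond_rate z a b) (ab, z)) =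
    (INF (a, b)\<in>topspace ?E. I\<^sub>A\<^sub>B (a, b) + total_cond_rate z a b)" for z
    by (intro INF_cong refl) auto
  show ?thesis
    using ABZ marginal.contraction_LDP[OF M ABZ] marginal.contraction_good
    unfolding rate_eq unfolding total_cond_rate_def J by simp
qed

end
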